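(* Assume the setting and the algorithm FDGM-AA described in the context, with $\beta\in(0,1/L)$, and assume B-connectivity: there is an integer $B\ge1$ such that for every $k\ge0$ the graph $(\mathcal V,\bigcup_{t=k}^{k+B-1}\mathcal E^t)$ is connected. Then for all $k\ge0$, $$ D(\mathbf w^k)-D^\star\le\frac{\tau R_0^2\,(D(\mathbf w^0)-D^\star)}{\tau R_0^2+\underline\lambda\lfloor k/B\rfloor\,(D(\mathbf w^0)-D^\star)}, $$ $$ \|\mathbf x^k-\mathbf x^\star\|\le\sqrt{2L\,(D(\mathbf w^k)-D^\star)},\qquad |F(\mathbf x^k)-F^\star|\le(R_0+\|\mathbf w^0\|)\sqrt{2L\,(D(\mathbf w^k)-D^\star)}, $$ where $\tau=\frac{3BL^2\tilde\eta}{\theta_2}+\frac{3}{\underline h\,\theta_1}$, $\theta_1=\min\{\beta(1-\beta L),c_1\}$, $\theta_2=\min\{(1/\beta-L)/2,c_2\}$.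
   Context: Setting. Let $n,d\ge 1$ be integers and $\mathcal V=\{1,\dots,n\}$. For each $i\in\mathcal V$, $f_i:\mathbb R^d\to\mathbb R\cup\{+\infty\}$ is proper, lower semicontinuous and $\mu$-strongly convex for some $\mu>0$ (i.e. $f_i-\frac{\mu}{2}\|\cdot\|^2$ is convex), and the interior of $\bigcap_{i\in\mathcal V}\mathrm{dom} f_i$ is nonempty. Let $d_i(w)=\sup_{x\in\mathbb R^d}\{\langle w,x\rangle-f_i(x)\}$ be the convex conjugate of $f_i$; it is differentiable with $L$-Lipschitz gradient where $L=1/\mu$, and $\nabla d_i(w)=\arg\max_x\{\langle w,x\rangle-f_i(x)\}$. For $\mathbf w=(w_1,\dots,w_n)\in(\mathbb R^d)^n$ put $D(\mathbf w)=\sum_{i\in\mathcal V}d_i(w_i)$. Networks. $\mathcal G^k=(\mathcal V,\mathcal E^k)$, $k\ge0$, is a sequence of undirected graphs; $\mathcal N_i^k=\{j:\{i,j\}\in\mathcal E^k\}$. For each $\{i,j\}\in\mathcal E^k$ a weight $h_{ij}^k=h_{ji}^k>0$ is given, with $\underline h:=\inf_{k\ge0}\min_{\{i,j\}\in\mathcal E^k}h_{ij}^k>0$ and $\sum_{j\in\mathcal N_i^k}h_{ij}^k\le 1$ for all $i,k$. Algorithm FDGM-AA. Parameters: step-size $\beta>0$, constants $c_1,c_2>0$, integer memory $m\ge1$. Initial point $w_1^0,\dots,w_n^0\in\mathbb R^d$ with $\sum_i w_i^0=0$. At iteration $k\ge0$, for each edge $\{i,j\}\in\mathcal E^k$: let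 $\mathcal I_{ij}^k=\mathcal I_{ji}^k$ be the set of the $\min\{m,N\}$ largest indices $t\le k$ with $\{i,j\}\in\mathcal E^t$, where $N$ is the number of such $t$ (so $k\in\mathcal I_{ij}^k$). Let $W_{ij}^k$ and $D_{ij}^k$ be the $d\times|\mathcal I_{ij}^k|$ matrices with columns $w_i^t$ and $\nabla d_i(w_i^t)$, $t\in\mathcal I_{ij}^k$, and define $W_{ji}^k$, $D_{ji}^k$ analogously with $w_j^t$, $\nabla d_j(w_j^t)$. Let $(\alpha_{ij}^k,\alpha_{ji}^k)$ be any minimizer of $\|D_{ij}^k\alpha_{ij}-D_{ji}^k\alpha_{ji}\|^2$ subject to $W_{ij}^k\alpha_{ij}+W_{ji}^k\alpha_{ji}=w_i^k+w_j^k$, $\mathbf 1^T\alpha_{ij}=1$, $\mathbf 1^T\alpha_{ji}=1$. Set $\tilde w_{ij}=W_{ij}^k\alpha_{ij}^k$, $\tilde w_{ji}=W_{ji}^k\alpha_{ji}^k$, $\bar w_{ij}=\tilde w_{ij}-\beta(D_{ij}^k\alpha_{ij}^k-D_{ji}^k\alpha_{ji}^k)$, $\bar w_{ji}=\tilde w_{ji}-\beta(D_{ji}^k\alpha_{ji}^k-D_{ij}^k\alpha_{ij}^k)$. Let $g=\nabla d_i(w_i^k)-\nabla d_j(w_j^k)$ and $\rho=\min\{-c_1\|g\|^2,\,-c_2(\|\bar w_{ij}-w_i^k\|^2+\|\bar w_{ji}-w_j^k\|^2)\}$. Safe-guard test (one of the following two, fixed for the whole run): (S1) $d_i(\bar w_{ij})+d_j(\bar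 w_{ji})-d_i(w_i^k)-d_j(w_j^k)\le\rho$; or (S2) $\langle\nabla d_i(w_i^k),\bar w_{ij}-w_i^k\rangle+\frac L2\|\bar w_{ij}-w_i^k\|^2+\langle\nabla d_j(w_j^k),\bar w_{ji}-w_j^k\rangle+\frac L2\|\bar w_{ji}-w_j^k\|^2\le\rho$. If the test holds, set $(w_{ij}^{k+\frac12},w_{ji}^{k+\frac12})=(\bar w_{ij},\bar w_{ji})$; otherwise set $w_{ij}^{k+\frac12}=w_i^k-\beta g$, $w_{ji}^{k+\frac12}=w_j^k+\beta g$. Finally, for every $i\in\mathcal V$, $w_i^{k+1}=(1-\sum_{j\in\mathcal N_i^k}h_{ij}^k)w_i^k+\sum_{j\in\mathcal N_i^k}h_{ij}^k w_{ij}^{k+\frac12}$. Write $\mathbf w^k=(w_1^k,\dots,w_n^k)$ and $x_i^k=\nabla d_i(w_i^k)$. Further notation. $\mathbf x^k=(x_1^k,\dots,x_n^k)$ and $F(\mathbf x)=\sum_i f_i(x_i)$. $F^\star$ is the optimal value and $\mathbf x^\star=(x^\star,\dots,x^\star)$ the (unique) optimal solution of minimizing $F(\mathbf x)$ subject to $x_1=\dots=x_n$; $D^\star$ is the optimal value of minimizing $D(\mathbf w)$ subject to $\sum_i w_i=0$. For $k\ge0$ let $\tilde{\mathcal E}^k=\bigcup_{t=k}^{k+B-1}\mathcal E^t$, $\tilde{\mathcal G}^k=(\mathcal V,\tilde{\mathcal E}^k)$, $\mathcal L_{\tilde{\mathcal G}^k}$ its (unweighted) graph Laplacian, $\eta^k$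 its maximum degree, $\tilde\eta=\sup_{t\ge0}\eta^{tB}$, and $\underline\lambda=\inf_{t\ge0}\lambda_{\min}(\mathcal L_{\tilde{\mathcal G}^{tB}})$, where $\lambda_{\min}$ denotes the smallest nonzero eigenvalue. $S_0=\{\mathbf w:D(\mathbf w)\le D(\mathbf w^0),\ \sum_i w_i=0\}$ (a compact set) and $R_0=\max\{\|\mathbf w-\mathbf u\|:\mathbf w,\mathbf u\in S_0\}$. *)

theory Defs
  imports "HOL-Analysis.Analysis" "HOL-Library.Extended_Real"
begin

text \<open>R^d is modelled by a type 'a of class euclidean_space; agents by a finite type 'v.\<close>

definition edom :: "('a \<Rightarrow> ereal) \<Rightarrow> 'a set" where
  "edom f = {x. f x < \<infinity>}"

definition proper_fun :: "('a \<Rightarrow> ereal) \<Rightarrow> bool" where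
  "proper_fun f \<longleftrightarrow> (\<forall>x. f x \<noteq> -\<infinity>) \<and> (\<exists>x. f x \<noteq> \<infinity>)"

definition lsc_fun :: "('a::topological_space \<Rightarrow> ereal) \<Rightarrow> bool" where
  "lsc_fun f \<longleftrightarrow> (\<forall>x. f x \<le> Liminf (at x) f)"

definition strongly_convex_fun :: "real \<Rightarrow> ('a::real_normed_vector \<Rightarrow> ereal) \<Rightarrow> bool" where
  "strongly_convex_fun \<mu> f \<longleftrightarrow> convex (edom f) \<and>
     convex_on (edom f) (\<lambda>x. real_of_ereal (f x) - \<mu> / 2 * (norm x)\<^sup>2)"

text \<open>Convex conjugate d(w) = sup_x <w,x> - f(x), as a real number (it is finite
  under the standing assumptions).\<close>
definition conj_fun :: "('a::real_inner \<Rightarrow> ereal) \<Rightarrow> 'a \<Rightarrow> real" where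
  "conj_fun f w = real_of_ereal (SUP x. ereal (inner w x) - f x)"

definition grad :: "('a::real_inner \<Rightarrow> real) \<Rightarrow> 'a \<Rightarrow> 'a" where
  "grad g w = (THE v. (g has_derivative (\<lambda>h. inner v h)) (at w))"

text \<open>Undirected edge sets are sets of two-element sets {i,j}.\<close>
definition nbrs :: "'v set set \<Rightarrow> 'v \<Rightarrow> 'v set" where
  "nbrs E i = {j. {i, j} \<in> E}"

definition graph_connected :: "'v set set \<Rightarrow> bool" where
  "graph_connected E \<longleftrightarrow> (\<forall>i j. (\<lambda>a b. {a, b} \<in> E)\<^sup>*\<^sup>* i j)"

definition union_edges :: "(nat \<Rightarrow> 'v set set) \<Rightarrow> nat \<Rightarrow> nat \<Rightarrow> 'v set set" where
  "union_edges E B k = (\<Union>t\<in>{k..<k+B}. E t)"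

definition degree :: "'v set set \<Rightarrow> 'v \<Rightarrow> nat" where
  "degree E i = card (nbrs E i)"

definition max_degree :: "'v::finite set set \<Rightarrow> nat" where
  "max_degree E = Max (range (degree E))"

definition laplacian :: "'v::finite set set \<Rightarrow> real ^ 'v ^ 'v" where
  "laplacian E = (\<chi> i j. if i = j then real (degree E i) else if {i, j} \<in> E then -1 else 0)"

definition lambda_min_nz :: "real ^ 'v ^ 'v \<Rightarrow> real" where
  "lambda_min_nz M = Inf {r. r \<noteq> 0 \<and> (\<exists>v. v \<noteq> 0 \<and> M *v v = r *s v)}"

text \<open>Memory index set I_ij^k: the min(m,N) largest t \<le> k with {i,j} in E^t.\<close>
definition mem_idx :: "(nat \<Rightarrow> 'v set set) \<Rightarrow> nat \<Rightarrow> nat \<Rightarrow> 'v \<Rightarrow> 'v \<Rightarrow> nat set" where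
  "mem_idx E m k i j = {t. t \<le> k \<and> {i, j} \<in> E t \<and>
       card {s. t \<le> s \<and> s \<le> k \<and> {i, j} \<in> E s} \<le> m}"

definition Wcomb :: "(nat \<Rightarrow> 'v \<Rightarrow> 'a::real_vector) \<Rightarrow> nat set \<Rightarrow> 'v \<Rightarrow> (nat \<Rightarrow> real) \<Rightarrow> 'a" where
  "Wcomb w I i a = (\<Sum>t\<in>I. a t *\<^sub>R w t i)"

definition Dcomb :: "('v \<Rightarrow> 'a \<Rightarrow> 'a) \<Rightarrow> (nat \<Rightarrow> 'v \<Rightarrow> 'a::real_vector) \<Rightarrow> nat set \<Rightarrow> 'v \<Rightarrow> (nat \<Rightarrow> real) \<Rightarrow> 'a" where
  "Dcomb dg w I i a = (\<Sum>t\<in>I. a t *\<^sub>R dg i (w t i))"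

definition aa_feasible ::
  "(nat \<Rightarrow> 'v set set) \<Rightarrow> nat \<Rightarrow> (nat \<Rightarrow> 'v \<Rightarrow> 'a::real_vector) \<Rightarrow> nat \<Rightarrow> 'v \<Rightarrow> 'v
    \<Rightarrow> (nat \<Rightarrow> real) \<Rightarrow> (nat \<Rightarrow> real) \<Rightarrow> bool" where
  "aa_feasible E m w k i j a b \<longleftrightarrow>
     (let I = mem_idx E m k i j in
       Wcomb w I i a + Wcomb w I j b = w k i + w k j \<and> sum a I = 1 \<and> sum b I = 1)"

definition aa_obj ::
  "(nat \<Rightarrow> 'v set set) \<Rightarrow> nat \<Rightarrow> ('v \<Rightarrow> 'a \<Rightarrow> 'a) \<Rightarrow> (nat \<Rightarrow> 'v \<Rightarrow> 'a::real_normed_vector)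
    \<Rightarrow> nat \<Rightarrow> 'v \<Rightarrow> 'v \<Rightarrow> (nat \<Rightarrow> real) \<Rightarrow> (nat \<Rightarrow> real) \<Rightarrow> real" where
  "aa_obj E m dg w k i j a b =
     (let I = mem_idx E m k i j in (norm (Dcomb dg w I i a - Dcomb dg w I j b))\<^sup>2)"

definition aa_minimizer ::
  "(nat \<Rightarrow> 'v set set) \<Rightarrow> nat \<Rightarrow> ('v \<Rightarrow> 'a \<Rightarrow> 'a) \<Rightarrow> (nat \<Rightarrow> 'v \<Rightarrow> 'a::real_normed_vector)
    \<Rightarrow> nat \<Rightarrow> 'v \<Rightarrow> 'v \<Rightarrow> (nat \<Rightarrow> real) \<Rightarrow> (nat \<Rightarrow> real) \<Rightarrow> bool" where
  "aa_minimizer E m dg w k i j a b \<longleftrightarrow>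
     aa_feasible E m w k i j a b \<and>
     (\<forall>a' b'. aa_feasible E m w k i j a' b' \<longrightarrow> aa_obj E m dg w k i j a b \<le> aa_obj E m dg w k i j a' b')"

text \<open>w_ij^{k+1/2}, computed from the candidate (a,b) = (alpha_ij^k, alpha_ji^k).
  The flag s selects the safeguard: True = (S1), False = (S2).
  dc i = d_i, dg i = gradient of d_i.\<close>
definition half_step ::
  "bool \<Rightarrow> real \<Rightarrow> real \<Rightarrow> real \<Rightarrow> real \<Rightarrow> (nat \<Rightarrow> 'v set set) \<Rightarrow> nat
    \<Rightarrow> ('v \<Rightarrow> 'a \<Rightarrow> real) \<Rightarrow> ('v \<Rightarrow> 'a \<Rightarrow> 'a) \<Rightarrow> (nat \<Rightarrow> 'v \<Rightarrow> 'a::real_inner)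
    \<Rightarrow> nat \<Rightarrow> 'v \<Rightarrow> 'v \<Rightarrow> (nat \<Rightarrow> real) \<Rightarrow> (nat \<Rightarrow> real) \<Rightarrow> 'a" where
  "half_step s L \<beta> c1 c2 E m dc dg w k i j a b =
     (let I = mem_idx E m k i j;
          wt_ij = Wcomb w I i a; wt_ji = Wcomb w I j b;
          Dij = Dcomb dg w I i a; Dji = Dcomb dg w I j b;
          wb_ij = wt_ij - \<beta> *\<^sub>R (Dij - Dji);
          wb_ji = wt_ji - \<beta> *\<^sub>R (Dji - Dij);
          g = dg i (w k i) - dg j (w k j);
          \<rho> = min (- c1 * (norm g)\<^sup>2)
                  (- c2 * ((norm (wb_ij - w k i))\<^sup>2 + (norm (wb_ji - w k j))\<^sup>2));
          test = (if s then
                    dc i wb_ij + dc j wb_ji - dc i (w k i) - dc j (w k j) \<le> \<rho>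
                  else
                    inner (dg i (w k i)) (wb_ij - w k i) + L / 2 * (norm (wb_ij - w k i))\<^sup>2
                    + inner (dg j (w k j)) (wb_ji - w k j) + L / 2 * (norm (wb_ji - w k j))\<^sup>2 \<le> \<rho>)
      in if test then wb_ij else w k i - \<beta> *\<^sub>R g)"

definition pnorm :: "('v::finite \<Rightarrow> 'a::real_normed_vector) \<Rightarrow> real" where
  "pnorm u = sqrt (\<Sum>i\<in>UNIV. (norm (u i))\<^sup>2)"

definition Dsum :: "('v::finite \<Rightarrow> 'a \<Rightarrow> real) \<Rightarrow> ('v \<Rightarrow> 'a) \<Rightarrow> real" where
  "Dsum dc u = (\<Sum>i\<in>UNIV. dc i (u i))"

definition Dstar :: "('v::finite \<Rightarrow> 'a::real_vector \<Rightarrow> real) \<Rightarrow> real" where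
  "Dstar dc = Inf {Dsum dc u | u. (\<Sum>i\<in>UNIV. u i) = 0}"

definition Fstar :: "('v::finite \<Rightarrow> 'a \<Rightarrow> ereal) \<Rightarrow> real" where
  "Fstar f = real_of_ereal (INF x. \<Sum>i\<in>UNIV. f i x)"

definition xstar :: "('v::finite \<Rightarrow> 'a \<Rightarrow> ereal) \<Rightarrow> 'a" where
  "xstar f = (THE x. \<forall>y. (\<Sum>i\<in>UNIV. f i x) \<le> (\<Sum>i\<in>UNIV. f i y))"

definition S0set :: "('v::finite \<Rightarrow> 'a::real_vector \<Rightarrow> real) \<Rightarrow> ('v \<Rightarrow> 'a) \<Rightarrow> ('v \<Rightarrow> 'a) set" where
  "S0set dc w0 = {u. Dsum dc u \<le> Dsum dc w0 \<and> (\<Sum>i\<in>UNIV. u i) = 0}"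

definition R0 :: "('v::finite \<Rightarrow> 'a::real_normed_vector \<Rightarrow> real) \<Rightarrow> ('v \<Rightarrow> 'a) \<Rightarrow> real" where
  "R0 dc w0 = Sup {pnorm (\<lambda>i. u i - v i) | u v. u \<in> S0set dc w0 \<and> v \<in> S0set dc w0}"

definition h_low :: "(nat \<Rightarrow> 'v set set) \<Rightarrow> (nat \<Rightarrow> 'v \<Rightarrow> 'v \<Rightarrow> real) \<Rightarrow> real" where
  "h_low E h = Inf {h k i j | k i j. {i, j} \<in> E k}"

definition eta_tilde :: "(nat \<Rightarrow> 'v::finite set set) \<Rightarrow> nat \<Rightarrow> real" where
  "eta_tilde E B = Sup {real (max_degree (union_edges E B (t * B))) | t. True}"

definition lambda_low :: "(nat \<Rightarrow> 'v::finite set set) \<Rightarrow> nat \<Rightarrow> real" where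
  "lambda_low E B = Inf {lambda_min_nz (laplacian (union_edges E B (t * B))) | t. True}"

end

theory Submission
  imports Defs
begin

text \<open>
  Strong convexity of f makes its conjugate d finite and differentiable, and the strong subgradient
  inequality for f at the gradients of d turns into
  d(w) + <grad d(w), v - w> + mu/2 |grad d(v) - grad d(w)|^2 <= d(v).
  Everything about the dual functions (convexity, the descent lemma with L = 1/mu, Lipschitz
  gradients) follows from this one inequality.

  Both branches of the safeguard preserve w_i + w_j and decrease d_i + d_j by at least
  theta1 |g|^2 and by at least theta2 times the squared displacement. Summed over the edges with
  weights h, the decrease of D over a window of B iterations therefore controls both the
  disagreement of the gradients across each edge at the moment the edge is active and the movement
  of the iterates in between; together they bound, with constant tau, the disagreement at the start
  of the window across all edges of the union graph. The spectral gap of its Laplacian and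
  D(w) - D* <= <w - w*, x - mean x> <= R0 |x - mean x| give
  lambda (D(w^k) - D*)^2 <= tau R0^2 (D(w^k) - D(w^(k+B))), which yields the O(1/k) rate.

  The primal bounds come from the displayed inequality at a dual optimum w*, where all gradients
  agree with x*, and from F* = - D*.
\<close>

section \<open>Conjugates of strongly convex functions\<close>

text \<open>A level strictly between \<open>\<phi> x\<close> and \<open>f x\<close> separates the
  two functions near \<open>x\<close>. A continuous \<open>\<phi>\<close> instead of a constant lets
  this serve for tilts of \<open>f\<close> by linear functionals.\<close>

lemma lsc_fun_closed_le_continuous:
  fixes f :: "'a::topological_space \<Rightarrow> ereal"
  assumes "lsc_fun f" and "continuous_on UNIV \<phi>"
  shows "closed {x. f x \<le> ereal (\<phi> x)}"
proof -
  have "\<exists>T. open T \<and> x \<in> T \<and> T \<subseteq> {x. ereal (\<phi> x) < f x}" if x: "ereal (\<phi> x) < f x" for x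
  proof -
    obtain q where q: "ereal (\<phi> x) < ereal q" "ereal q < f x"
      using ereal_dense2[OF x] by auto
    have "ereal q < Liminf (at x) f"
      using q(2) assms(1) unfolding lsc_fun_def by (meson less_le_trans)
    then have "eventually (\<lambda>y. ereal q < f y) (at x)"
      by (rule less_LiminfD)
    then obtain U where U: "open U" "x \<in> U" "\<And>y. y \<in> U \<Longrightarrow> y \<noteq> x \<Longrightarrow> ereal q < f y"
      unfolding eventually_at_topological by auto
    have "open (\<phi> -` {..<q})"
      using assms(2) by (simp add: continuous_on_open_vimage)
    then have "open (U \<inter> \<phi> -` {..<q})" using U(1) by blast
    moreover have "x \<in> U \<inter> \<phi> -` {..<q}" using U(2) q(1) by simp
    moreover have "U \<inter> \<phi> -` {..<q} \<subseteq> {x. ereal (\<phi> x) < f x}"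
    proof
      fix y assume y: "y \<in> U \<inter> \<phi> -` {..<q}"
      \<comment> \<open>\<open>at x\<close> is punctured, so \<open>U(3)\<close> is silent about
        \<open>y = x\<close>; there \<open>q(2)\<close> applies.\<close>
      then have "ereal q < f y" using U(3)[of y] q(2) by (cases "y = x") auto
      moreover have "ereal (\<phi> y) < ereal q" using y by simp
      ultimately show "y \<in> {x. ereal (\<phi> x) < f x}" by (metis less_trans mem_Collect_eq)
    qed
    ultimately show ?thesis by blast
  qed
  then have "open {x. ereal (\<phi> x) < f x}"
    by (subst open_subopen) auto
  moreover have "- {x. f x \<le> ereal (\<phi> x)} = {x. ereal (\<phi> x) < f x}" by auto
  ultimately show ?thesis unfolding closed_def by simp
qed

text \<open>Finite intersection property for the sublevel sets at the values taken on
  \<open>K\<close>: a common point is a minimizer. Closed sublevel sets take the place of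
  continuity.\<close>

lemma compact_attains_min_closed_sublevels:
  fixes h :: "'a::topological_space \<Rightarrow> 'b::linorder"
  assumes "compact K" "K \<noteq> {}" and cl: "\<And>c. closed {x. h x \<le> c}"
  shows "\<exists>x\<in>K. \<forall>y\<in>K. h x \<le> h y"
proof -
  define F where "F = (\<lambda>y. {x. h x \<le> h y}) ` K"
  have "K \<inter> \<Inter>F \<noteq> {}"
  proof (rule compact_imp_fip[OF assms(1)])
    show "closed T" if "T \<in> F" for T using that cl unfolding F_def by auto
    fix F' assume "finite F'" "F' \<subseteq> F"
    then obtain Y where Y: "Y \<subseteq> K" "finite Y" "F' = (\<lambda>y. {x. h x \<le> h y}) ` Y"
      unfolding F_def by (meson finite_subset_image)
    show "K \<inter> \<Inter>F' \<noteq> {}"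
    proof (cases "Y = {}")
      case True then show ?thesis using Y assms(2) by auto
    next
      case False
      then have "Min (h ` Y) \<in> h ` Y" using Y(2) by (intro Min_in) auto
      then obtain y where "y \<in> Y" "h y = Min (h ` Y)" by auto
      then have "y \<in> K \<inter> \<Inter>F'" using Y by auto
      then show ?thesis by blast
    qed
  qed
  then show ?thesis unfolding F_def by blast
qed

lemma norm_convex_combination_sq:
  fixes x y :: "'a::real_inner"
  shows "(norm ((1 - t) *\<^sub>R x + t *\<^sub>R y))\<^sup>2
    = (1 - t) * (norm x)\<^sup>2 + t * (norm y)\<^sup>2 - t * (1 - t) * (norm (x - y))\<^sup>2"
  by (simp add: power2_norm_eq_inner inner_simps inner_commute algebra_simps)

lemma strongly_convex_funD:
  fixes f :: "'a::real_inner \<Rightarrow> ereal"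
  assumes sc: "strongly_convex_fun \<mu> f" and xy: "x \<in> edom f" "y \<in> edom f" and t: "0 \<le> t" "t \<le> 1"
  shows "(1 - t) *\<^sub>R x + t *\<^sub>R y \<in> edom f"
    and "real_of_ereal (f ((1 - t) *\<^sub>R x + t *\<^sub>R y))
      \<le> (1 - t) * real_of_ereal (f x) + t * real_of_ereal (f y) - \<mu> / 2 * (t * (1 - t) * (norm (x - y))\<^sup>2)"
proof -
  show "(1 - t) *\<^sub>R x + t *\<^sub>R y \<in> edom f"
    using sc xy t unfolding strongly_convex_fun_def convex_alt by auto
  have "convex_on (edom f) (\<lambda>x. real_of_ereal (f x) - \<mu> / 2 * (norm x)\<^sup>2)"
    using sc unfolding strongly_convex_fun_def by simp
  from convex_onD[OF this t xy]
  show "real_of_ereal (f ((1 - t) *\<^sub>R x + t *\<^sub>R y))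
      \<le> (1 - t) * real_of_ereal (f x) + t * real_of_ereal (f y) - \<mu> / 2 * (t * (1 - t) * (norm (x - y))\<^sup>2)"
    unfolding norm_convex_combination_sq by (simp add: field_simps)
qed

lemma proper_fun_ereal_real:
  assumes "proper_fun f" "x \<in> edom f"
  shows "ereal (real_of_ereal (f x)) = f x"
  using assms unfolding proper_fun_def edom_def by (cases "f x") auto

text \<open>Coercivity is derived: compactness bounds \<open>f\<close> below on the unit ball around
  a domain point, and strong convexity along rays propagates this to quadratic growth, so the search
  is confined to a ball.\<close>

lemma strongly_convex_closed_minimizer:
  fixes f :: "'a::euclidean_space \<Rightarrow> ereal"
  assumes mu: "\<mu> > 0" and pr: "proper_fun f" and cl: "\<And>c. closed {x. f x \<le> c}"
    and sc: "strongly_convex_fun \<mu> f"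
  shows "\<exists>x\<in>edom f. \<forall>y\<in>edom f.
    real_of_ereal (f x) + \<mu> / 2 * (norm (y - x))\<^sup>2 \<le> real_of_ereal (f y)"
proof -
  define F where "F = (\<lambda>x. real_of_ereal (f x))"
  have fF: "f x = ereal (F x)" if "x \<in> edom f" for x
    using proper_fun_ereal_real[OF pr that] unfolding F_def by simp
  obtain x0 where x0: "x0 \<in> edom f"
    using pr unfolding proper_fun_def edom_def by auto
  obtain z where z: "z \<in> cball x0 1" "\<And>y. y \<in> cball x0 1 \<Longrightarrow> f z \<le> f y"
    using compact_attains_min_closed_sublevels[OF compact_cball _ cl, of x0 1] by auto
  have "f z \<le> f x0" using z(2) by simp
  then have zd: "z \<in> edom f" using x0 unfolding edom_def by auto
  \<comment> \<open>Chosen so that \<open>r > M\<close> gives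
    \<open>\<mu> / 2 * (r - 1) > \<bar>F z\<bar> + \<bar>F x0\<bar>\<close>.\<close>
  define M where "M = 1 + 2 * (\<bar>F z\<bar> + \<bar>F x0\<bar>) / \<mu>"
  have far: "F x0 < F x" if x: "x \<in> edom f" and r: "norm (x - x0) > M" for x
  proof -
    define r where "r = norm (x - x0)"
    have "M \<ge> 1" unfolding M_def using mu by simp
    then have r1: "r > 1" using r r_def by simp
    \<comment> \<open>The point \<open>y\<close> of the segment from \<open>x0\<close> to
      \<open>x\<close> then has distance 1 from \<open>x0\<close>, where \<open>F z\<close> is a
      lower bound; multiplying by \<open>r\<close> isolates \<open>F x\<close>.\<close>
    define t where "t = 1 / r"
    have t: "0 \<le> t" "t \<le> 1" using r1 unfolding t_def by auto
    define y where "y = (1 - t) *\<^sub>R x0 + t *\<^sub>R x"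
    have y: "y \<in> edom f" using strongly_convex_funD(1)[OF sc x0 x t] y_def by simp
    have "y - x0 = t *\<^sub>R (x - x0)" unfolding y_def by (simp add: algebra_simps)
    then have "norm (y - x0) = 1" using r1 unfolding t_def r_def by auto
    then have "f z \<le> f y" using z(2) by (simp add: dist_norm norm_minus_commute)
    then have "F z \<le> F y" using fF zd y by simp
    also have "F y \<le> (1 - t) * F x0 + t * F x - \<mu> / 2 * (t * (1 - t) * r\<^sup>2)"
      using strongly_convex_funD(2)[OF sc x0 x t] unfolding y_def F_def r_def
      by (simp add: norm_minus_commute)
    finally have "r * F z \<le> r * ((1 - t) * F x0 + t * F x - \<mu> / 2 * (t * (1 - t) * r\<^sup>2))"
      using r1 by (intro mult_left_mono) auto
    also have "\<dots> = (r - 1) * F x0 + F x - \<mu> / 2 * (r * (r - 1))"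
      using r1 unfolding t_def by (simp add: field_simps power2_eq_square)
    finally have 1: "r * F z + \<mu> / 2 * (r * (r - 1)) - r * F x0 \<le> F x - F x0"
      by (simp add: algebra_simps)
    have "\<mu> / 2 * (r - 1) > \<bar>F z\<bar> + \<bar>F x0\<bar>"
      using r mu unfolding M_def r_def by (simp add: field_simps)
    then have "0 < F z + \<mu> / 2 * (r - 1) - F x0" by linarith
    then have "0 < r * (F z + \<mu> / 2 * (r - 1) - F x0)" using r1 by simp
    then show ?thesis using 1 by (simp add: algebra_simps)
  qed
  obtain x where x: "x \<in> cball x0 (max M 0)" "\<And>y. y \<in> cball x0 (max M 0) \<Longrightarrow> f x \<le> f y"
    using compact_attains_min_closed_sublevels[OF compact_cball _ cl, of x0 "max M 0"] by auto
  have fx0: "f x \<le> f x0" using x(2) by simp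
  then have xd: "x \<in> edom f" using x0 unfolding edom_def by auto
  have Fmin: "F x \<le> F y" if "y \<in> edom f" for y
  proof (cases "norm (y - x0) > M")
    case True
    then show ?thesis using far[OF that] fx0 fF[OF xd] fF[OF x0] by simp
  next
    case False
    then have "f x \<le> f y" using x(2) by (simp add: dist_norm norm_minus_commute)
    then show ?thesis using fF[OF xd] fF[OF that] by simp
  qed
  have "F x + \<mu> / 2 * (norm (y - x))\<^sup>2 \<le> F y" if y: "y \<in> edom f" for y
  proof -
    \<comment> \<open>Comparing \<open>x\<close> with the point of the segment that has weight
      \<open>1 - u\<close> on \<open>y\<close> and dividing by \<open>1 - u\<close> loses only a
      factor \<open>u\<close>, which tends to 1.\<close>
    have "\<mu> / 2 * (norm (y - x))\<^sup>2 \<le> F y - F x"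
    proof (rule field_le_mult_one_interval)
      fix u :: real assume u: "0 < u" "u < 1"
      have t: "0 \<le> 1 - u" "1 - u \<le> 1" using u by auto
      have "F x \<le> F ((1 - (1 - u)) *\<^sub>R x + (1 - u) *\<^sub>R y)"
        by (rule Fmin[OF strongly_convex_funD(1)[OF sc xd y t]])
      also have "\<dots> \<le> (1 - (1 - u)) * F x + (1 - u) * F y
          - \<mu> / 2 * ((1 - u) * (1 - (1 - u)) * (norm (x - y))\<^sup>2)"
        using strongly_convex_funD(2)[OF sc xd y t] unfolding F_def by simp
      finally have "(1 - u) * (u * (\<mu> / 2 * (norm (y - x))\<^sup>2)) \<le> (1 - u) * (F y - F x)"
        by (simp add: field_simps norm_minus_commute)
      then show "u * (\<mu> / 2 * (norm (y - x))\<^sup>2) \<le> F y - F x" using u by simp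
    qed
    then show ?thesis by simp
  qed
  then show ?thesis using xd unfolding F_def by blast
qed

text \<open>A minimizer of the tilt \<open>h\<close> is a point at which \<open>w\<close> is a
  subgradient of \<open>f\<close>; tilting keeps the domain and the modulus
  \<open>\<mu>\<close>.\<close>

lemma strong_subgradient_exists:
  fixes f :: "'a::euclidean_space \<Rightarrow> ereal"
  assumes mu: "\<mu> > 0" and pr: "proper_fun f" and lsc: "lsc_fun f"
    and sc: "strongly_convex_fun \<mu> f"
  shows "\<exists>x\<in>edom f. \<forall>y\<in>edom f.
    real_of_ereal (f x) + inner w (y - x) + \<mu> / 2 * (norm (y - x))\<^sup>2 \<le> real_of_ereal (f y)"
proof -
  define h where "h = (\<lambda>x. f x - ereal (inner w x))"
  have dom: "edom h = edom f"
  proof -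
    have "(h x < \<infinity>) = (f x < \<infinity>)" for x unfolding h_def by (cases "f x") auto
    then show ?thesis unfolding edom_def by auto
  qed
  have re: "real_of_ereal (h x) = real_of_ereal (f x) - inner w x" if "x \<in> edom f" for x
    using proper_fun_ereal_real[OF pr that] unfolding h_def by (cases "f x") auto
  have "proper_fun h"
  proof -
    have "h x \<noteq> -\<infinity>" for x using pr unfolding h_def proper_fun_def by (cases "f x") auto
    moreover have "\<exists>x. h x \<noteq> \<infinity>"
      using dom pr unfolding edom_def proper_fun_def by (metis (mono_tags) ereal_infty_less(1) mem_Collect_eq)
    ultimately show ?thesis unfolding proper_fun_def by simp
  qed
  moreover have "closed {x. h x \<le> c}" for c
  proof (cases c)
    case (real r)
    have "(h x \<le> ereal r) = (f x \<le> ereal (r + inner w x))" for x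
      unfolding h_def by (cases "f x") auto
    then have "{x. h x \<le> c} = {x. f x \<le> ereal (r + inner w x)}" using real by simp
    moreover have "continuous_on UNIV (\<lambda>x. r + inner w x)" by (intro continuous_intros)
    ultimately show ?thesis using lsc_fun_closed_le_continuous[OF lsc] by simp
  next
    case MInf
    have "{x. h x \<le> c} = {}" using \<open>proper_fun h\<close> MInf unfolding proper_fun_def by auto
    then show ?thesis by simp
  qed auto
  moreover have "strongly_convex_fun \<mu> h"
  proof -
    have "convex_on (edom f) (\<lambda>x. (real_of_ereal (f x) - \<mu> / 2 * (norm x)\<^sup>2) + inner (- w) x)"
    proof (rule convex_on_add)
      show "convex_on (edom f) (\<lambda>x. real_of_ereal (f x) - \<mu> / 2 * (norm x)\<^sup>2)"
        using sc unfolding strongly_convex_fun_def by simp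
      show "convex_on (edom f) (inner (- w))"
        using sc unfolding strongly_convex_fun_def convex_on_def by (simp add: inner_simps)
    qed
    moreover have "convex_on (edom f) (\<lambda>x. real_of_ereal (h x) - \<mu> / 2 * (norm x)\<^sup>2) \<longleftrightarrow>
        convex_on (edom f) (\<lambda>x. (real_of_ereal (f x) - \<mu> / 2 * (norm x)\<^sup>2) + inner (- w) x)"
    proof -
      \<comment> \<open>\<open>re\<close> rewrites values only on \<open>edom f\<close>, so convex
        combinations must be known to stay there.\<close>
      have "\<And>x y u v. \<lbrakk>x \<in> edom f; y \<in> edom f; 0 \<le> u; 0 \<le> v; u + v = 1\<rbrakk> \<Longrightarrow> u *\<^sub>R x + v *\<^sub>R y \<in> edom f"
        using sc unfolding strongly_convex_fun_def convex_def by blast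
      then show ?thesis unfolding convex_on_def by (simp add: re diff_diff_eq add.commute)
    qed
    ultimately have "convex_on (edom f) (\<lambda>x. real_of_ereal (h x) - \<mu> / 2 * (norm x)\<^sup>2)"
      by simp
    then show ?thesis using sc unfolding strongly_convex_fun_def dom by simp
  qed
  ultimately obtain x where x: "x \<in> edom h"
    "\<And>y. y \<in> edom h \<Longrightarrow> real_of_ereal (h x) + \<mu> / 2 * (norm (y - x))\<^sup>2 \<le> real_of_ereal (h y)"
    using strongly_convex_closed_minimizer[OF mu] by blast
  then show ?thesis unfolding dom using re by (force simp: inner_diff_right algebra_simps)
qed

text \<open>Equality case of Fenchel-Young. The supremum is computed in \<open>ereal\<close>, since
  \<open>real_of_ereal\<close> would silently send an infinite one to 0.\<close>

lemma conj_fun_eqI: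
  fixes f :: "'a::real_inner \<Rightarrow> ereal"
  assumes pr: "proper_fun f" and x: "x \<in> edom f"
    and sub: "\<And>y. y \<in> edom f \<Longrightarrow> real_of_ereal (f x) + inner w (y - x) \<le> real_of_ereal (f y)"
  shows "conj_fun f w = inner w x - real_of_ereal (f x)"
proof -
  have "(SUP y. ereal (inner w y) - f y) = ereal (inner w x - real_of_ereal (f x))"
  proof (rule SUP_eqI)
    fix y :: 'a
    show "ereal (inner w y) - f y \<le> ereal (inner w x - real_of_ereal (f x))"
    proof (cases "y \<in> edom f")
      case True
      then show ?thesis using sub[OF True] proper_fun_ereal_real[OF pr True]
        by (cases "f y") (auto simp: inner_diff_right)
    next
      case False
      then show ?thesis unfolding edom_def by simp
    qed
  next
    fix u assume "\<And>i. i \<in> UNIV \<Longrightarrow> ereal (inner w i) - f i \<le> u"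
    then have "ereal (inner w x) - f x \<le> u" by simp
    then show "ereal (inner w x - real_of_ereal (f x)) \<le> u"
      using proper_fun_ereal_real[OF pr x] by (cases "f x") auto
  qed
  then show ?thesis unfolding conj_fun_def by simp
qed

lemma grad_eqI:
  fixes g :: "'a::real_inner \<Rightarrow> real"
  assumes "(g has_derivative (\<lambda>h. inner v h)) (at w)"
  shows "grad g w = v"
  unfolding grad_def
proof (rule the_equality)
  fix u assume "(g has_derivative (\<lambda>h. inner u h)) (at w)"
  then have "(\<lambda>h. inner u h) = (\<lambda>h. inner v h)"
    using assms by (rule has_derivative_unique)
  then have "inner (u - v) (u - v) = 0" by (metis inner_diff_left right_minus_eq)
  then show "u = v" by simp
qed (use assms in simp)

section \<open>Cocoercive gradients and the gradient of the conjugate\<close>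

text \<open>Characterises convex functions with a \<open>1 / \<mu>\<close>-Lipschitz gradient
  without mentioning derivatives; \<open>g\<close> is an arbitrary map here and turns out to be the
  gradient.\<close>

definition cocoercive_grad :: "real \<Rightarrow> ('a::real_inner \<Rightarrow> real) \<Rightarrow> ('a \<Rightarrow> 'a) \<Rightarrow> bool" where
  "cocoercive_grad \<mu> d g \<longleftrightarrow>
    (\<forall>v w. d w + inner (g w) (v - w) + \<mu> / 2 * (norm (g v - g w))\<^sup>2 \<le> d v)"

lemma cocoercive_gradD:
  "cocoercive_grad \<mu> d g \<Longrightarrow> d w + inner (g w) (v - w) + \<mu> / 2 * (norm (g v - g w))\<^sup>2 \<le> d v"
  unfolding cocoercive_grad_def by blast

lemma cocoercive_grad_supporting:
  assumes "\<mu> > 0" "cocoercive_grad \<mu> d g"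
  shows "d w + inner (g w) (v - w) \<le> d v"
proof -
  have "0 \<le> \<mu> / 2 * (norm (g v - g w))\<^sup>2" using assms(1) by simp
  then show ?thesis using cocoercive_gradD[OF assms(2), of w v] by linarith
qed

text \<open>The inequality is used based at \<open>v\<close>. Replacing \<open>g v\<close> by
  \<open>g w\<close> costs \<open>inner a (v - w)\<close>, and Young's inequality is weighted so
  that its \<open>a\<close> term cancels the cocoercive term.\<close>

lemma cocoercive_grad_descent:
  assumes mu: "\<mu> > 0" and c: "cocoercive_grad \<mu> d g"
  shows "d v \<le> d w + inner (g w) (v - w) + 1 / \<mu> / 2 * (norm (v - w))\<^sup>2"
proof -
  define a where "a = g v - g w"
  have "d v + inner (g v) (w - v) + \<mu> / 2 * (norm a)\<^sup>2 \<le> d w"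
    using cocoercive_gradD[OF c, of v w] unfolding a_def by (simp add: norm_minus_commute)
  moreover have "inner (g v) (w - v) = - inner (g w) (v - w) - inner a (v - w)"
    unfolding a_def by (simp add: inner_simps)
  moreover have "inner a (v - w) \<le> \<mu> / 2 * (norm a)\<^sup>2 + 1 / \<mu> / 2 * (norm (v - w))\<^sup>2"
  proof -
    have "0 \<le> (norm (\<mu> *\<^sub>R a - (v - w)))\<^sup>2 / (2 * \<mu>)" using mu by simp
    also have "(norm (\<mu> *\<^sub>R a - (v - w)))\<^sup>2 =
        \<mu>\<^sup>2 * (norm a)\<^sup>2 - 2 * \<mu> * inner a (v - w) + (norm (v - w))\<^sup>2"
      unfolding power2_norm_eq_inner
      by (simp add: inner_diff_left inner_diff_right inner_commute power2_eq_square algebra_simps)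
    also have "\<dots> / (2 * \<mu>) = \<mu> / 2 * (norm a)\<^sup>2 + 1 / \<mu> / 2 * (norm (v - w))\<^sup>2 - inner a (v - w)"
      using mu by (simp add: field_simps power2_eq_square)
    finally show ?thesis by simp
  qed
  ultimately show ?thesis by linarith
qed

text \<open>Adding the inequality to its copy with \<open>v\<close> and \<open>w\<close> exchanged
  cancels the function values; Cauchy-Schwarz does the rest.\<close>

lemma cocoercive_grad_lipschitz:
  assumes mu: "\<mu> > 0" and c: "cocoercive_grad \<mu> d g"
  shows "norm (g v - g w) \<le> 1 / \<mu> * norm (v - w)"
proof -
  have "d w + inner (g w) (v - w) + \<mu> / 2 * (norm (g v - g w))\<^sup>2 \<le> d v"
    "d v + inner (g v) (w - v) + \<mu> / 2 * (norm (g w - g v))\<^sup>2 \<le> d w"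
    using cocoercive_gradD[OF c] by blast+
  then have "\<mu> * (norm (g v - g w))\<^sup>2 \<le> inner (g v - g w) (v - w)"
    by (simp add: inner_simps norm_minus_commute)
  also have "\<dots> \<le> norm (g v - g w) * norm (v - w)" by (rule norm_cauchy_schwarz)
  finally have "norm (g v - g w) * (\<mu> * norm (g v - g w)) \<le> norm (g v - g w) * norm (v - w)"
    by (simp add: power2_eq_square algebra_simps)
  then have "\<mu> * norm (g v - g w) \<le> norm (v - w)"
    by (cases "norm (g v - g w) = 0") auto
  then show ?thesis using mu by (simp add: field_simps)
qed

text \<open>The linearization error lies between 0 (supporting inequality) and
  \<open>1 / \<mu> / 2\<close> times the squared distance (descent inequality), which gives the
  radius \<open>2 * \<mu> * e\<close>.\<close>

lemma cocoercive_grad_has_derivative: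
  assumes mu: "\<mu> > 0" and c: "cocoercive_grad \<mu> d g"
  shows "(d has_derivative (\<lambda>h. inner (g w) h)) (at w)"
  unfolding has_derivative_within_alt
proof (intro conjI allI impI)
  show "bounded_linear (inner (g w))" by (rule bounded_linear_inner_right)
  fix e :: real assume e: "e > 0"
  show "\<exists>\<delta>>0. \<forall>y\<in>UNIV. norm (y - w) < \<delta> \<longrightarrow>
      norm (d y - d w - inner (g w) (y - w)) \<le> e * norm (y - w)"
  proof (intro exI conjI ballI impI)
    show "0 < 2 * \<mu> * e" using e mu by simp
    fix y assume y: "norm (y - w) < 2 * \<mu> * e"
    have "1 / \<mu> / 2 * (norm (y - w))\<^sup>2 = (norm (y - w) / (2 * \<mu>)) * norm (y - w)"
      by (simp add: power2_eq_square)
    also have "\<dots> \<le> e * norm (y - w)"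
      using y mu by (intro mult_right_mono) (auto simp: field_simps)
    finally show "norm (d y - d w - inner (g w) (y - w)) \<le> e * norm (y - w)"
      using cocoercive_grad_descent[OF mu c, of y w] cocoercive_grad_supporting[OF mu c, of w y]
      unfolding real_norm_def by linarith
  qed
qed

text \<open>All four facts are proved for one selection \<open>X\<close> of points with subgradient
  \<open>w\<close>; cocoercivity then identifies \<open>X\<close> with the gradient.\<close>

lemma conj_fun_gradient:
  fixes f :: "'a::euclidean_space \<Rightarrow> ereal"
  assumes mu: "\<mu> > 0" and pr: "proper_fun f" and lsc: "lsc_fun f"
    and sc: "strongly_convex_fun \<mu> f"
  shows conj_fun_cocoercive: "cocoercive_grad \<mu> (conj_fun f) (grad (conj_fun f))"
    and grad_conj_fun_in_edom: "grad (conj_fun f) w \<in> edom f"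
    and fenchel_equality:
      "conj_fun f w = inner w (grad (conj_fun f) w) - real_of_ereal (f (grad (conj_fun f) w))"
    and strong_subgradient: "\<And>y. y \<in> edom f \<Longrightarrow>
      real_of_ereal (f (grad (conj_fun f) w)) + inner w (y - grad (conj_fun f) w)
        + \<mu> / 2 * (norm (y - grad (conj_fun f) w))\<^sup>2 \<le> real_of_ereal (f y)"
proof -
  obtain X where X: "\<And>w. X w \<in> edom f" "\<And>w y. y \<in> edom f \<Longrightarrow>
      real_of_ereal (f (X w)) + inner w (y - X w) + \<mu> / 2 * (norm (y - X w))\<^sup>2 \<le> real_of_ereal (f y)"
    using strong_subgradient_exists[OF mu pr lsc sc] by metis
  have conj: "conj_fun f w = inner w (X w) - real_of_ereal (f (X w))" for w
  proof (rule conj_fun_eqI[OF pr X(1)])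
    fix y assume "y \<in> edom f"
    moreover have "0 \<le> \<mu> / 2 * (norm (y - X w))\<^sup>2" using mu by simp
    ultimately show "real_of_ereal (f (X w)) + inner w (y - X w) \<le> real_of_ereal (f y)"
      using X(2)[of y w] by linarith
  qed
  have coc: "cocoercive_grad \<mu> (conj_fun f) X"
    unfolding cocoercive_grad_def
  proof (intro allI)
    fix v w
    \<comment> \<open>The strong subgradient inequality at \<open>v\<close>, tested at the point
      \<open>X w\<close>; \<open>conj\<close> replaces both values of \<open>f\<close>.\<close>
    show "conj_fun f w + inner (X w) (v - w) + \<mu> / 2 * (norm (X v - X w))\<^sup>2 \<le> conj_fun f v"
      using X(2)[OF X(1)[of w], of v] unfolding conj
      by (simp add: inner_simps inner_commute norm_minus_commute)
  qed
  have g: "grad (conj_fun f) = X"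
    using grad_eqI[OF cocoercive_grad_has_derivative[OF mu coc]] by blast
  show "cocoercive_grad \<mu> (conj_fun f) (grad (conj_fun f))"
    "grad (conj_fun f) w \<in> edom f"
    "conj_fun f w = inner w (grad (conj_fun f) w) - real_of_ereal (f (grad (conj_fun f) w))"
    "\<And>y. y \<in> edom f \<Longrightarrow>
      real_of_ereal (f (grad (conj_fun f) w)) + inner w (y - grad (conj_fun f) w)
        + \<mu> / 2 * (norm (y - grad (conj_fun f) w))\<^sup>2 \<le> real_of_ereal (f y)"
    unfolding g using coc X conj by auto
qed

section \<open>The dual problem\<close>

text \<open>Passing to the type of vectors over \<open>'v\<close> gives the triangle inequality,
  Cauchy-Schwarz and compactness arguments for families.\<close>

lemma pnorm_eq_norm_vec: "pnorm u = norm (\<chi> i. u i)"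
  unfolding pnorm_def norm_vec_def L2_set_def by simp

lemma pnorm_nonneg [simp]: "0 \<le> pnorm u"
  unfolding pnorm_def by (simp add: sum_nonneg)

lemma pnorm_sq: "(pnorm u)\<^sup>2 = (\<Sum>i\<in>UNIV. (norm (u i))\<^sup>2)"
  unfolding pnorm_def by (simp add: sum_nonneg)

lemma pnorm_le_sum: "pnorm u \<le> (\<Sum>i\<in>UNIV. norm (u i))"
  unfolding pnorm_def using L2_set_le_sum[of UNIV "\<lambda>i. norm (u i)"] by (simp add: L2_set_def)

lemma pnorm_le_diff_add: "pnorm u \<le> pnorm (\<lambda>i. u i - v i) + pnorm v"
proof -
  have "(\<chi> i. u i) = (\<chi> i. u i - v i) + (\<chi> i. v i)" by (simp add: vec_eq_iff)
  then show ?thesis unfolding pnorm_eq_norm_vec by (metis norm_triangle_ineq)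
qed

lemma sum_inner_le_pnorm:
  fixes u v :: "'v::finite \<Rightarrow> 'a::real_inner"
  shows "\<bar>\<Sum>i\<in>UNIV. inner (u i) (v i)\<bar> \<le> pnorm u * pnorm v"
  using Cauchy_Schwarz_ineq2[of "\<chi> i. u i" "\<chi> i. v i"] unfolding pnorm_eq_norm_vec inner_vec_def by simp

section \<open>Dual optima, equality of their gradients, and the radius of the sublevel set\<close>

text \<open>\<open>growth\<close> is coercivity of the dual objective on the zero-sum subspace; it
  carries the information from the interior of the common domain.\<close>

locale dual_problem =
  fixes d :: "'v::finite \<Rightarrow> 'a::euclidean_space \<Rightarrow> real" and g :: "'v \<Rightarrow> 'a \<Rightarrow> 'a" and \<mu> :: real
  assumes mu_pos: "\<mu> > 0"
    and cocoercive: "\<And>i. cocoercive_grad \<mu> (d i) (g i)"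
    and growth: "\<exists>r>0. \<exists>C. \<forall>u. (\<Sum>i\<in>UNIV. u i) = 0 \<longrightarrow> r * (\<Sum>i\<in>UNIV. norm (u i)) \<le> Dsum d u + C"
begin

lemma Dsum_cocoercive:
  "Dsum d u + (\<Sum>i\<in>UNIV. inner (g i (u i)) (v i - u i))
    + \<mu> / 2 * (\<Sum>i\<in>UNIV. (norm (g i (v i) - g i (u i)))\<^sup>2) \<le> Dsum d v"
  unfolding Dsum_def sum_distrib_left sum.distrib[symmetric]
  by (intro sum_mono cocoercive_gradD[OF cocoercive])

lemma Dsum_supporting:
  "Dsum d u + (\<Sum>i\<in>UNIV. inner (g i (u i)) (v i - u i)) \<le> Dsum d v"
  unfolding Dsum_def sum.distrib[symmetric]
  by (intro sum_mono cocoercive_grad_supporting[OF mu_pos cocoercive])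

lemma continuous_on_d: "continuous_on S (d i)"
  using cocoercive_grad_has_derivative[OF mu_pos cocoercive]
  by (meson continuous_at_imp_continuous_on has_derivative_continuous)

lemma sublevel_bounded: "\<exists>M. \<forall>u. (\<Sum>i\<in>UNIV. u i) = 0 \<and> Dsum d u \<le> c \<longrightarrow> pnorm u \<le> M"
proof -
  obtain r C where r: "r > 0"
    "\<And>u. (\<Sum>i\<in>UNIV. u i) = 0 \<Longrightarrow> r * (\<Sum>i\<in>UNIV. norm (u i)) \<le> Dsum d u + C"
    using growth by blast
  have "pnorm u \<le> (c + C) / r" if "(\<Sum>i\<in>UNIV. u i) = 0" "Dsum d u \<le> c" for u
  proof -
    have "(\<Sum>i\<in>UNIV. norm (u i)) \<le> (c + C) / r"
      using r(2)[OF that(1)] that(2) r(1) by (simp add: field_simps)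
    then show ?thesis using pnorm_le_sum[of u] by linarith
  qed
  then show ?thesis by blast
qed

lemma dual_optimum_exists:
  "\<exists>u. (\<Sum>i\<in>UNIV. u i) = 0 \<and> (\<forall>v. (\<Sum>i\<in>UNIV. v i) = 0 \<longrightarrow> Dsum d u \<le> Dsum d v)"
proof -
  obtain M where M: "\<And>u. (\<Sum>i\<in>UNIV. u i) = 0 \<Longrightarrow> Dsum d u \<le> Dsum d (\<lambda>_. 0) \<Longrightarrow> pnorm u \<le> M"
    using sublevel_bounded by blast
  define K where "K = cball 0 M \<inter> {U :: 'a^'v. (\<Sum>i\<in>UNIV. U $ i) = 0}"
  have "closed {U :: 'a^'v. (\<Sum>i\<in>UNIV. U $ i) = 0}"
    by (intro closed_Collect_eq continuous_intros)
  then have "compact K" unfolding K_def by (intro compact_Int_closed) auto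
  moreover have "0 \<le> M" using M[of "\<lambda>_. 0"] pnorm_nonneg[of "\<lambda>_::'v. 0::'a"] by (simp add: pnorm_def)
  then have 0: "0 \<in> K" unfolding K_def by simp
  moreover have "continuous_on K (\<lambda>U. \<Sum>i\<in>UNIV. d i (U $ i))"
    by (intro continuous_intros continuous_on_compose2[OF continuous_on_d]) auto
  ultimately obtain U where U: "U \<in> K" "\<And>V. V \<in> K \<Longrightarrow> (\<Sum>i\<in>UNIV. d i (U $ i)) \<le> (\<Sum>i\<in>UNIV. d i (V $ i))"
    using continuous_attains_inf[of K] by blast
  have "Dsum d (\<lambda>i. U $ i) \<le> Dsum d v" if v: "(\<Sum>i\<in>UNIV. v i) = 0" for v
  \<comment> \<open>A competitor above the value at 0 may lie outside \<open>K\<close>, but it loses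
    to 0, which lies in \<open>K\<close>.\<close>
  proof (cases "Dsum d v \<le> Dsum d (\<lambda>_. 0)")
    case True
    then have "(\<chi> i. v i) \<in> K" using M[OF v] v unfolding K_def pnorm_eq_norm_vec by simp
    then show ?thesis using U(2) unfolding Dsum_def by fastforce
  next
    case False
    then show ?thesis using U(2)[OF 0] unfolding Dsum_def by simp
  qed
  moreover have "(\<Sum>i\<in>UNIV. U $ i) = 0" using U(1) K_def by simp
  ultimately show ?thesis by blast
qed

lemma Dstar_eq_optimum:
  assumes "(\<Sum>i\<in>UNIV. u i) = 0" "\<And>v. (\<Sum>i\<in>UNIV. v i) = 0 \<Longrightarrow> Dsum d u \<le> Dsum d v"
  shows "Dstar d = Dsum d u"
  unfolding Dstar_def by (rule cInf_eq_minimum) (use assms in auto)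

text \<open>Moving mass from \<open>i\<close> to \<open>j\<close> along the gradient difference
  keeps the sum zero, and by the descent inequality it would lower the objective unless that
  difference vanishes.\<close>

lemma optimum_gradients_equal:
  assumes u: "(\<Sum>i\<in>UNIV. u i) = 0" "\<And>v. (\<Sum>i\<in>UNIV. v i) = 0 \<Longrightarrow> Dsum d u \<le> Dsum d v"
  shows "g i (u i) = g j (u j)"
proof (cases "i = j")
  case False
  define q where "q = g i (u i) - g j (u j)"
  \<comment> \<open>Minimizes \<open>s\<^sup>2 / \<mu> - s\<close>, the coefficient of the squared
    norm of \<open>q\<close> in the change; the minimum is \<open>- \<mu> / 4\<close>.\<close>
  define s where "s = \<mu> / 2"
  define v where "v = u(i := u i - s *\<^sub>R q, j := u j + s *\<^sub>R q)"
  have *: "(\<Sum>l\<in>UNIV. F l) = F i + F j + (\<Sum>l\<in>UNIV - {i} - {j}. F l)" for F :: "'v \<Rightarrow> 'b::comm_monoid_add"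
    using False by (simp add: sum.remove[of UNIV i] sum.remove[of "UNIV - {i}" j] add.assoc)
  have "(\<Sum>l\<in>UNIV. v l) = (\<Sum>l\<in>UNIV. u l)"
    unfolding * v_def using False by simp
  then have "Dsum d u \<le> Dsum d v" using u by simp
  then have "d i (u i) + d j (u j) \<le> d i (u i - s *\<^sub>R q) + d j (u j + s *\<^sub>R q)"
    unfolding Dsum_def * v_def using False by simp
  also have "\<dots> \<le> d i (u i) - s * inner (g i (u i)) q + 1 / \<mu> / 2 * (s\<^sup>2 * (norm q)\<^sup>2)
      + (d j (u j) + s * inner (g j (u j)) q + 1 / \<mu> / 2 * (s\<^sup>2 * (norm q)\<^sup>2))"
    using cocoercive_grad_descent[OF mu_pos cocoercive, of i "u i - s *\<^sub>R q" "u i"]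
      cocoercive_grad_descent[OF mu_pos cocoercive, of j "u j + s *\<^sub>R q" "u j"]
    by (simp add: power_mult_distrib)
  also have "\<dots> = d i (u i) + d j (u j) - s * inner q q + s\<^sup>2 / \<mu> * (norm q)\<^sup>2"
    unfolding q_def by (simp add: inner_simps algebra_simps)
  finally have "\<mu> / 4 * (norm q)\<^sup>2 \<le> 0"
    using mu_pos unfolding s_def power2_norm_eq_inner by (simp add: power2_eq_square)
  then have "q = 0" using mu_pos by (simp add: mult_le_0_iff)
  then show ?thesis unfolding q_def by simp
qed simp

text \<open>\<open>R0\<close> is a real \<open>Sup\<close>, so its set must be shown bounded; this
  is where coercivity enters.\<close>

lemma pnorm_diff_le_R0:
  assumes "u \<in> S0set d w0" "v \<in> S0set d w0"
  shows "pnorm (\<lambda>i. u i - v i) \<le> R0 d w0"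
  unfolding R0_def
proof (rule cSup_upper)
  show "pnorm (\<lambda>i. u i - v i) \<in> {pnorm (\<lambda>i. u i - v i) |u v. u \<in> S0set d w0 \<and> v \<in> S0set d w0}"
    using assms by blast
  obtain M where M: "\<And>u. u \<in> S0set d w0 \<Longrightarrow> pnorm u \<le> M"
    using sublevel_bounded[of "Dsum d w0"] unfolding S0set_def by blast
  have "pnorm (\<lambda>i. u i - v i) \<le> 2 * M" if "u \<in> S0set d w0" "v \<in> S0set d w0" for u v
  proof -
    have "pnorm (\<lambda>i. u i - v i) \<le> pnorm (\<lambda>i. u i) + pnorm (\<lambda>i. v i)"
      using norm_triangle_ineq4[of "\<chi> i. u i" "\<chi> i. v i"] unfolding pnorm_eq_norm_vec
      by (simp add: vector_minus_component minus_vec_def)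
    then show ?thesis using M[OF that(1)] M[OF that(2)] by simp
  qed
  then show "bdd_above {pnorm (\<lambda>i. u i - v i) |u v. u \<in> S0set d w0 \<and> v \<in> S0set d w0}"
    by (intro bdd_aboveI[of _ "2 * M"]) blast
qed

text \<open>\<open>c\<close> is free because differences of zero-sum points are orthogonal to
  constant families; the mean of the gradients is the choice that matters later.\<close>

lemma dual_gap_bound:
  assumes u: "u \<in> S0set d w0"
  shows "Dsum d u - Dstar d \<le> R0 d w0 * pnorm (\<lambda>i. g i (u i) - c)"
proof -
  obtain v where v: "(\<Sum>i\<in>UNIV. v i) = 0" "\<And>u. (\<Sum>i\<in>UNIV. u i) = 0 \<Longrightarrow> Dsum d v \<le> Dsum d u"
    using dual_optimum_exists by blast
  have u0: "(\<Sum>i\<in>UNIV. u i) = 0" using u unfolding S0set_def by simp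
  have "Dsum d v \<le> Dsum d u" using v(2)[OF u0] .
  then have vS: "v \<in> S0set d w0" using u v(1) unfolding S0set_def by auto
  have "Dsum d u - Dsum d v \<le> - (\<Sum>i\<in>UNIV. inner (g i (u i)) (v i - u i))"
    using Dsum_supporting[of u v] by linarith
  also have "\<dots> = (\<Sum>i\<in>UNIV. inner (g i (u i)) (u i - v i))"
    by (simp add: sum_negf[symmetric] inner_diff_right)
  also have "\<dots> = (\<Sum>i\<in>UNIV. inner (g i (u i) - c) (u i - v i))"
  proof -
    have "(\<Sum>i\<in>UNIV. inner c (u i - v i)) = 0"
      using u0 v(1) by (simp add: inner_sum_right[symmetric] sum_subtractf)
    then show ?thesis by (simp add: inner_diff_left sum_subtractf)
  qed
  also have "\<dots> \<le> pnorm (\<lambda>i. g i (u i) - c) * pnorm (\<lambda>i. u i - v i)"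
    using sum_inner_le_pnorm[of "\<lambda>i. g i (u i) - c" "\<lambda>i. u i - v i"] by linarith
  also have "\<dots> \<le> pnorm (\<lambda>i. g i (u i) - c) * R0 d w0"
    by (intro mult_left_mono pnorm_diff_le_R0[OF u vS]) simp
  finally have "Dsum d u - Dsum d v \<le> R0 d w0 * pnorm (\<lambda>i. g i (u i) - c)"
    by (simp add: mult.commute)
  moreover have "Dstar d = Dsum d v" using v by (rule Dstar_eq_optimum)
  ultimately show ?thesis by simp
qed

end

section \<open>Spectral gap of graph Laplacians\<close>

text \<open>Edge sums run over ordered pairs, so every edge occurs twice; hence the factors 1/2 from
  here on. Exchanging end points rests on the symmetry of \<open>nbrs\<close>.\<close>

lemma sum_nbrs_swap:
  fixes E :: "'v::finite set set"
  shows "(\<Sum>i\<in>UNIV. \<Sum>j\<in>nbrs E i. \<phi> i j) = (\<Sum>i\<in>UNIV. \<Sum>j\<in>nbrs E i. \<phi> j i)"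
proof -
  have "(\<Sum>i\<in>UNIV. \<Sum>j\<in>nbrs E i. \<phi> i j) = (\<Sum>i\<in>UNIV. \<Sum>j\<in>{j. j \<in> UNIV \<and> j \<in> nbrs E i}. \<phi> i j)"
    by simp
  also have "\<dots> = (\<Sum>j\<in>UNIV. \<Sum>i\<in>{i. i \<in> UNIV \<and> j \<in> nbrs E i}. \<phi> i j)"
    by (rule sum.swap_restrict) auto
  also have "\<dots> = (\<Sum>i\<in>UNIV. \<Sum>j\<in>nbrs E i. \<phi> j i)"
  proof -
    have "{i. i \<in> UNIV \<and> j \<in> nbrs E i} = nbrs E j" for j
      unfolding nbrs_def by (simp add: insert_commute)
    then show ?thesis by simp
  qed
  finally show ?thesis .
qed

lemma laplacian_mult_nth:
  fixes E :: "'v::finite set set"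
  assumes "\<And>i. i \<notin> nbrs E i"
  shows "(laplacian E *v x) $ i = (\<Sum>j\<in>nbrs E i. x $ i - x $ j)"
proof -
  have "(laplacian E *v x) $ i = (\<Sum>j\<in>UNIV. (if i = j then real (degree E i) * x $ i else 0)
      - (if j \<in> nbrs E i then x $ j else 0))"
    unfolding matrix_vector_mult_def laplacian_def
    using assms by (auto simp: nbrs_def intro!: sum.cong)
  also have "\<dots> = real (degree E i) * x $ i - (\<Sum>j\<in>nbrs E i. x $ j)"
    by (simp add: sum_subtractf sum.If_cases)
  finally show ?thesis by (simp add: degree_def sum_subtractf)
qed

text \<open>Source of the properties below: symmetry in \<open>x\<close> and \<open>y\<close> gives
  self-adjointness, \<open>y = x\<close> a sum of squares, and \<open>y = 1\<close> that the range
  is orthogonal to the constants.\<close>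

lemma laplacian_form:
  fixes E :: "'v::finite set set"
  assumes "\<And>i. i \<notin> nbrs E i"
  shows "2 * inner y (laplacian E *v x)
    = (\<Sum>i\<in>UNIV. \<Sum>j\<in>nbrs E i. (y $ i - y $ j) * (x $ i - x $ j))"
proof -
  have "inner y (laplacian E *v x) = (\<Sum>i\<in>UNIV. \<Sum>j\<in>nbrs E i. y $ i * (x $ i - x $ j))"
    unfolding inner_vec_def laplacian_mult_nth[OF assms] by (simp add: sum_distrib_left)
  moreover have "\<dots> = (\<Sum>i\<in>UNIV. \<Sum>j\<in>nbrs E i. y $ j * (x $ j - x $ i))"
    by (rule sum_nbrs_swap)
  ultimately have "2 * inner y (laplacian E *v x) =
      (\<Sum>i\<in>UNIV. \<Sum>j\<in>nbrs E i. y $ i * (x $ i - x $ j)) + (\<Sum>i\<in>UNIV. \<Sum>j\<in>nbrs E i. y $ j * (x $ j - x $ i))"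
    by simp
  also have "\<dots> = (\<Sum>i\<in>UNIV. \<Sum>j\<in>nbrs E i. (y $ i - y $ j) * (x $ i - x $ j))"
    unfolding sum.distrib[symmetric] by (intro sum.cong) (auto simp: algebra_simps)
  finally show ?thesis .
qed

lemma laplacian_self_adjoint:
  fixes E :: "'v::finite set set"
  assumes "\<And>i. i \<notin> nbrs E i"
  shows "inner y (laplacian E *v x) = inner x (laplacian E *v y)"
  using laplacian_form[OF assms, of y x] laplacian_form[OF assms, of x y] by (simp add: mult.commute)

lemma laplacian_psd:
  fixes E :: "'v::finite set set"
  assumes "\<And>i. i \<notin> nbrs E i"
  shows "0 \<le> inner x (laplacian E *v x)"
proof -
  have "0 \<le> (\<Sum>i\<in>UNIV. \<Sum>j\<in>nbrs E i. (x $ i - x $ j) * (x $ i - x $ j))"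
    by (intro sum_nonneg) auto
  then show ?thesis using laplacian_form[OF assms, of x x] by linarith
qed

lemma laplacian_eigenvalue_nonneg:
  fixes E :: "'v::finite set set"
  assumes "\<And>i. i \<notin> nbrs E i" "v \<noteq> 0" "laplacian E *v v = r *s v"
  shows "0 \<le> r"
proof -
  have "inner v (laplacian E *v v) = r * inner v v"
    unfolding assms(3) by (simp add: scalar_mult_eq_scaleR)
  moreover have "0 < inner v v" using assms(2) by simp
  moreover have "0 \<le> inner v (laplacian E *v v)" by (rule laplacian_psd[OF assms(1)])
  ultimately show ?thesis by (metis zero_le_mult_iff not_less)
qed

lemma laplacian_kernel_const:
  fixes E :: "'v::finite set set"
  assumes loopfree: "\<And>i. i \<notin> nbrs E i" and conn: "graph_connected E"
    and zero: "inner x (laplacian E *v x) = 0"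
  shows "x $ i = x $ j"
proof -
  have "(\<Sum>i\<in>UNIV. \<Sum>j\<in>nbrs E i. (x $ i - x $ j) * (x $ i - x $ j)) = 0"
    using laplacian_form[OF loopfree, of x x] zero by simp
  then have "\<forall>i\<in>UNIV. (\<Sum>j\<in>nbrs E i. (x $ i - x $ j) * (x $ i - x $ j)) = 0"
    by (subst (asm) sum_nonneg_eq_0_iff) (auto intro: sum_nonneg)
  then have "\<forall>i. \<forall>j\<in>nbrs E i. (x $ i - x $ j) * (x $ i - x $ j) = 0"
    by (subst (asm) sum_nonneg_eq_0_iff) auto
  then have edge: "{a, b} \<in> E \<Longrightarrow> x $ a = x $ b" for a b unfolding nbrs_def by simp
  have "(\<lambda>a b. {a, b} \<in> E)\<^sup>*\<^sup>* i j" using conn unfolding graph_connected_def by blast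
  then show ?thesis by induction (use edge in auto)
qed

text \<open>The minimiser of the Rayleigh quotient on the orthogonal complement of the constant vectors
  is an eigenvector; its eigenvalue is nonzero because the graph is connected.\<close>

lemma laplacian_rayleigh_minimizer:
  fixes E :: "'v::finite set set"
  assumes loopfree: "\<And>i. i \<notin> nbrs E i" and conn: "graph_connected E"
    and two: "CARD('v) \<ge> 2"
  obtains r v where "r > 0" "v \<noteq> 0" "laplacian E *v v = r *s v"
    "\<And>x. (\<Sum>i\<in>UNIV. x $ i) = 0 \<Longrightarrow> r * inner x x \<le> inner x (laplacian E *v x)"
proof -
  define A where "A = laplacian E"
  define K where "K = sphere 0 1 \<inter> {x :: real^'v. (\<Sum>i\<in>UNIV. x $ i) = 0}"
  have "closed {x :: real^'v. (\<Sum>i\<in>UNIV. x $ i) = 0}"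
    by (intro closed_Collect_eq continuous_intros)
  then have "compact K" unfolding K_def by (intro compact_Int_closed) auto
  moreover have "K \<noteq> {}"
  proof -
    obtain a b :: 'v where ab: "a \<noteq> b"
      using two card_2_iff'[of "UNIV :: 'v set"] by (metis (full_types) UNIV_I card_le_Suc0_iff_eq finite_class.finite_UNIV not_less_eq_eq numeral_2_eq_2)
    define y :: "real^'v" where "y = axis a 1 - axis b 1"
    have "y \<noteq> 0" using ab unfolding y_def by (metis axis_eq_axis eq_iff_diff_eq_0 zero_neq_one)
    moreover have "(\<Sum>i\<in>UNIV. y $ i) = 0"
      unfolding y_def axis_def by (simp add: sum_subtractf)
    ultimately have "(1 / norm y) *\<^sub>R y \<in> K"
      unfolding K_def by (simp add: sum_divide_distrib[symmetric])
    then show ?thesis by blast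
  qed
  moreover have "continuous_on K (\<lambda>x. inner x (A *v x))"
    by (intro continuous_intros matrix_vector_mult_linear_continuous_on)
  ultimately obtain v where v: "v \<in> K" "\<And>x. x \<in> K \<Longrightarrow> inner v (A *v v) \<le> inner x (A *v x)"
    using continuous_attains_inf[of K] by blast
  define r where "r = inner v (A *v v)"
  have vn: "inner v v = 1" and v0: "(\<Sum>i\<in>UNIV. v $ i) = 0"
    using v(1) unfolding K_def by (auto simp: norm_eq_1)
  then have vne: "v \<noteq> 0" by auto
  have ray: "r * inner x x \<le> inner x (A *v x)" if x: "(\<Sum>i\<in>UNIV. x $ i) = 0" for x
  proof (cases "x = 0")
    case False
    define y where "y = (1 / norm x) *\<^sub>R x"
    have "y \<in> K" unfolding K_def y_def using False x by (simp add: sum_divide_distrib[symmetric])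
    then have "r \<le> inner y (A *v y)" unfolding r_def by (rule v(2))
    also have "\<dots> = inner x (A *v x) / (norm x)\<^sup>2"
      unfolding y_def by (simp add: matrix_vector_mult_scaleR power2_eq_square)
    finally show ?thesis using False by (simp add: field_simps power2_norm_eq_inner)
  qed simp
  have sa: "inner y (A *v x) = inner x (A *v y)" for x y
    unfolding A_def by (rule laplacian_self_adjoint[OF loopfree])
  \<comment> \<open>The residual of the eigenvalue equation. It sums to zero, so
    \<open>v + t *\<^sub>R z\<close> is admissible in \<open>ray\<close>, and the first-order term
    there is \<open>2 * t * inner z z\<close>.\<close>
  define z where "z = A *v v - r *\<^sub>R v"
  have z0: "(\<Sum>i\<in>UNIV. z $ i) = 0"
  proof -
    have "(\<Sum>i\<in>UNIV. (A *v v) $ i) = inner 1 (A *v v)" unfolding inner_vec_def by simp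
    also have "\<dots> = 0"
      using laplacian_form[OF loopfree, of 1 v] unfolding A_def by simp
    finally show ?thesis unfolding z_def using v0
      by (simp add: sum_subtractf sum_distrib_left[symmetric])
  qed
  have "inner z z = 0"
  proof (rule ccontr)
    assume nz: "inner z z \<noteq> 0"
    define c where "c = inner z (A *v z) - r * inner z z"
    have key: "0 \<le> 2 * t * inner z z + t\<^sup>2 * c" for t
    proof -
      have "(\<Sum>i\<in>UNIV. (v + t *\<^sub>R z) $ i) = 0"
        using v0 z0 by (simp add: sum.distrib sum_distrib_left[symmetric])
      then have "r * inner (v + t *\<^sub>R z) (v + t *\<^sub>R z) \<le> inner (v + t *\<^sub>R z) (A *v (v + t *\<^sub>R z))"
        by (rule ray)
      also have "\<dots> = r + 2 * t * inner z (A *v v) + t\<^sup>2 * inner z (A *v z)"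
        using sa[of v z] unfolding r_def
        by (simp add: matrix_vector_right_distrib matrix_vector_mult_scaleR inner_simps power2_eq_square algebra_simps)
      also have "inner z (A *v v) = inner z z + r * inner z v"
        unfolding z_def by (simp add: inner_diff_left inner_diff_right)
      finally show ?thesis using vn unfolding c_def
        by (simp add: inner_simps inner_commute power2_eq_square algebra_simps)
    qed
    define p where "p = inner z z"
    have p: "p > 0" using nz unfolding p_def by simp
    \<comment> \<open>Negative and small enough for the linear term to dominate; the
      \<open>+ 1\<close> keeps the denominator positive when \<open>c = 0\<close>.\<close>
    define t where "t = - p / (\<bar>c\<bar> + 1)"
    have "2 * t * p + t\<^sup>2 * c < 0"
    proof -
      have t: "t < 0" unfolding t_def using p by (simp add: field_simps)
      have "\<bar>t * c\<bar> < p"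
      proof -
        have "\<bar>t * c\<bar> = p * (\<bar>c\<bar> / (\<bar>c\<bar> + 1))" unfolding t_def using p by (simp add: abs_mult)
        also have "\<dots> < p * 1" using p by (intro mult_strict_left_mono) auto
        finally show ?thesis by simp
      qed
      then have "0 < 2 * p + t * c" using p by linarith
      then have "t * (2 * p + t * c) < 0" using t by (simp add: mult_neg_pos)
      then show ?thesis by (simp add: power2_eq_square algebra_simps)
    qed
    then show False using key[of t] unfolding p_def by simp
  qed
  then have "A *v v = r *s v" unfolding z_def by (simp add: scalar_mult_eq_scaleR)
  moreover have "r > 0"
  proof -
    \<comment> \<open>Otherwise \<open>v\<close> is constant by connectivity, hence 0 because its
      entries sum to 0.\<close>
    have "r \<noteq> 0"
    proof
      assume "r = 0"
      then have eq: "v $ i = v $ j" for i j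
        using laplacian_kernel_const[OF loopfree conn] unfolding r_def A_def by blast
      obtain i where i: "v $ i \<noteq> 0" using vne by (auto simp: vec_eq_iff)
      have "(\<Sum>j\<in>UNIV. v $ j) = (\<Sum>j\<in>(UNIV::'v set). v $ i)" using eq by (intro sum.cong) auto
      then show False using v0 i by simp
    qed
    then show ?thesis using laplacian_psd[OF loopfree, of v] unfolding r_def A_def by simp
  qed
  ultimately show thesis using that vne ray unfolding A_def by blast
qed

section \<open>Spectral gap for scalar and vector-valued families\<close>

text \<open>The Rayleigh minimum is a member of the set whose \<open>Inf\<close> is taken, and that
  set is bounded below by 0, so the infimum is at most this minimum and inherits its Rayleigh
  bound.\<close>

lemma lambda_min_nz_laplacian:
  fixes E :: "'v::finite set set"
  assumes loopfree: "\<And>i. i \<notin> nbrs E i" and conn: "graph_connected E"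
    and two: "CARD('v) \<ge> 2"
  shows lambda_min_nz_laplacian_nonneg: "0 \<le> lambda_min_nz (laplacian E)"
    and lambda_min_nz_laplacian_rayleigh: "(\<Sum>i\<in>UNIV. x $ i) = 0 \<Longrightarrow>
      lambda_min_nz (laplacian E) * inner x x \<le> inner x (laplacian E *v x)"
proof -
  obtain r v where rv: "r > 0" "v \<noteq> 0" "laplacian E *v v = r *s v"
    "\<And>x. (\<Sum>i\<in>UNIV. x $ i) = 0 \<Longrightarrow> r * inner x x \<le> inner x (laplacian E *v x)"
    using laplacian_rayleigh_minimizer[OF assms] by metis
  define S where "S = {r. r \<noteq> 0 \<and> (\<exists>v. v \<noteq> 0 \<and> laplacian E *v v = r *s v)}"
  have rS: "r \<in> S" using rv unfolding S_def by auto
  have nn: "0 \<le> s" if "s \<in> S" for s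
    using that laplacian_eigenvalue_nonneg[OF loopfree] unfolding S_def by blast
  show "0 \<le> lambda_min_nz (laplacian E)"
    unfolding lambda_min_nz_def S_def[symmetric] using rS nn by (intro cInf_greatest) auto
  have le: "lambda_min_nz (laplacian E) \<le> r"
    unfolding lambda_min_nz_def S_def[symmetric]
    using rS nn by (intro cInf_lower bdd_belowI) auto
  assume "(\<Sum>i\<in>UNIV. x $ i) = 0"
  from rv(4)[OF this] show "lambda_min_nz (laplacian E) * inner x x \<le> inner x (laplacian E *v x)"
    using mult_right_mono[OF le inner_ge_zero[of x]] by linarith
qed

text \<open>The scalar Rayleigh bound is applied to each coordinate of the deviation, which sums to
  zero over the agents, and then summed over \<open>Basis\<close>.\<close>

lemma spectral_gap_deviation_from_mean:
  fixes E :: "'v::finite set set" and x :: "'v \<Rightarrow> 'a::euclidean_space"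
  assumes loopfree: "\<And>i. i \<notin> nbrs E i" and conn: "graph_connected E"
    and two: "CARD('v) \<ge> 2"
  defines "c \<equiv> (1 / real CARD('v)) *\<^sub>R (\<Sum>i\<in>UNIV. x i)"
  shows "lambda_min_nz (laplacian E) * (pnorm (\<lambda>i. x i - c))\<^sup>2
    \<le> 1 / 2 * (\<Sum>i\<in>UNIV. \<Sum>j\<in>nbrs E i. (norm (x i - x j))\<^sup>2)"
proof -
  define y where "y = (\<lambda>b::'a. \<chi> i. inner (x i - c) b)"
  have "(\<Sum>i\<in>UNIV. x i - c) = 0"
    unfolding sum_subtractf sum_constant_scaleR c_def by simp
  then have y0: "(\<Sum>i\<in>UNIV. y b $ i) = 0" for b
    unfolding y_def vec_lambda_beta inner_sum_left[symmetric] by simp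
  have nsq: "(norm z)\<^sup>2 = (\<Sum>b\<in>Basis. (inner z b)\<^sup>2)" for z :: 'a
    unfolding power2_norm_eq_inner by (subst euclidean_inner, simp only: power2_eq_square)
  have "(pnorm (\<lambda>i. x i - c))\<^sup>2 = (\<Sum>i\<in>UNIV. \<Sum>b\<in>Basis. (inner (x i - c) b)\<^sup>2)"
    unfolding pnorm_sq nsq ..
  also have "\<dots> = (\<Sum>b\<in>Basis. inner (y b) (y b))"
    unfolding y_def inner_vec_def by (subst sum.swap, simp add: power2_eq_square)
  finally have "lambda_min_nz (laplacian E) * (pnorm (\<lambda>i. x i - c))\<^sup>2
      = (\<Sum>b\<in>Basis. lambda_min_nz (laplacian E) * inner (y b) (y b))"
    by (simp add: sum_distrib_left)
  also have "\<dots> \<le> (\<Sum>b\<in>Basis. inner (y b) (laplacian E *v y b))"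
    by (intro sum_mono lambda_min_nz_laplacian_rayleigh[OF loopfree conn two] y0)
  also have "\<dots> = (\<Sum>b\<in>Basis. 1 / 2 * (\<Sum>i\<in>UNIV. \<Sum>j\<in>nbrs E i. (inner (x i - x j) b)\<^sup>2))"
  proof (intro sum.cong refl)
    fix b :: 'a
    have "2 * inner (y b) (laplacian E *v y b) = (\<Sum>i\<in>UNIV. \<Sum>j\<in>nbrs E i. (inner (x i - x j) b)\<^sup>2)"
      unfolding laplacian_form[OF loopfree] y_def
      by (simp add: inner_diff_left power2_eq_square)
    then show "inner (y b) (laplacian E *v y b) = 1 / 2 * (\<Sum>i\<in>UNIV. \<Sum>j\<in>nbrs E i. (inner (x i - x j) b)\<^sup>2)"
      by simp
  qed
  also have "\<dots> = 1 / 2 * (\<Sum>b\<in>Basis. \<Sum>i\<in>UNIV. \<Sum>j\<in>nbrs E i. (inner (x i - x j) b)\<^sup>2)"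
    by (simp add: sum_distrib_left)
  also have "(\<Sum>b\<in>Basis. \<Sum>i\<in>UNIV. \<Sum>j\<in>nbrs E i. (inner (x i - x j) b)\<^sup>2)
      = (\<Sum>i\<in>UNIV. \<Sum>j\<in>nbrs E i. \<Sum>b\<in>Basis. (inner (x i - x j) b)\<^sup>2)"
  proof -
    have "(\<Sum>b\<in>Basis. \<Sum>i\<in>UNIV. \<Sum>j\<in>nbrs E i. (inner (x i - x j) b)\<^sup>2)
        = (\<Sum>i\<in>UNIV. \<Sum>b\<in>Basis. \<Sum>j\<in>nbrs E i. (inner (x i - x j) b)\<^sup>2)"
      by (rule sum.swap)
    also have "\<dots> = (\<Sum>i\<in>UNIV. \<Sum>j\<in>nbrs E i. \<Sum>b\<in>Basis. (inner (x i - x j) b)\<^sup>2)"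
      by (intro sum.cong refl sum.swap)
    finally show ?thesis .
  qed
  finally show ?thesis unfolding nsq .
qed

section \<open>Averaging of pairwise dual descent steps\<close>

text \<open>Jensen for the squared norm, with the missing weight placed at 0; it comes from
  expanding the weighted sum of squared distances to \<open>z\<close>.\<close>

lemma norm_weighted_sum_sq_le:
  fixes v :: "'b \<Rightarrow> 'a::real_inner"
  assumes "finite A" "\<And>j. j \<in> A \<Longrightarrow> 0 \<le> c j" "(\<Sum>j\<in>A. c j) \<le> 1"
  shows "(norm (\<Sum>j\<in>A. c j *\<^sub>R v j))\<^sup>2 \<le> (\<Sum>j\<in>A. c j * (norm (v j))\<^sup>2)"
proof -
  define z where "z = (\<Sum>j\<in>A. c j *\<^sub>R v j)"
  have "0 \<le> (\<Sum>j\<in>A. c j * (norm (v j - z))\<^sup>2)"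
    by (intro sum_nonneg mult_nonneg_nonneg assms(2)) auto
  also have "\<dots> = (\<Sum>j\<in>A. c j * (norm (v j))\<^sup>2 - 2 * inner (c j *\<^sub>R v j) z + c j * (norm z)\<^sup>2)"
    unfolding power2_norm_eq_inner
    by (intro sum.cong refl) (simp add: inner_diff_left inner_diff_right inner_commute algebra_simps)
  also have "\<dots> = (\<Sum>j\<in>A. c j * (norm (v j))\<^sup>2) - 2 * inner z z + (\<Sum>j\<in>A. c j) * (norm z)\<^sup>2"
    unfolding z_def inner_sum_left
    by (simp add: sum.distrib sum_subtractf sum_distrib_left sum_distrib_right)
  also have "\<dots> \<le> (\<Sum>j\<in>A. c j * (norm (v j))\<^sup>2) - 2 * inner z z + 1 * (norm z)\<^sup>2"
    using assms(3) by (intro add_left_mono mult_right_mono) auto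
  finally show ?thesis unfolding z_def[symmetric] power2_norm_eq_inner by simp
qed

lemma norm_add3_sq_le:
  fixes a b c :: "'a::real_normed_vector"
  shows "(norm (a + b + c))\<^sup>2 \<le> 3 * ((norm a)\<^sup>2 + (norm b)\<^sup>2 + (norm c)\<^sup>2)"
proof -
  have "norm (a + b + c) \<le> norm a + norm b + norm c"
    by (meson add_mono_thms_linordered_semiring(3) norm_triangle_le order_refl order_trans norm_triangle_ineq)
  then have "(norm (a + b + c))\<^sup>2 \<le> (norm a + norm b + norm c)\<^sup>2"
    by (intro power_mono) auto
  also have "\<dots> \<le> 3 * ((norm a)\<^sup>2 + (norm b)\<^sup>2 + (norm c)\<^sup>2)"
  proof -
    have "0 \<le> (norm a - norm b)\<^sup>2 + (norm b - norm c)\<^sup>2 + (norm a - norm c)\<^sup>2" by simp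
    then show ?thesis by (simp add: power2_eq_square algebra_simps)
  qed
  finally show ?thesis .
qed

text \<open>In reciprocals, the recursion says that \<open>1 / a n\<close> grows by at least
  \<open>l / q\<close> per step. The induction is kept free of denominators because \<open>a\<close>
  may reach 0.\<close>

lemma quadratic_decrease_rate:
  fixes a :: "nat \<Rightarrow> real"
  assumes nonneg: "\<And>n. 0 \<le> a n" and dec: "\<And>n. a (Suc n) \<le> a n" and l: "0 \<le> l" and q: "0 < q"
    and rec: "\<And>n. l * (a n)\<^sup>2 \<le> q * (a n - a (Suc n))"
  shows "a n \<le> q * a 0 / (q + l * real n * a 0)"
proof -
  have "a n * (q + l * real n * a 0) \<le> q * a 0"
  proof (induction n)
    case (Suc n)
    show ?case
    proof (cases "a (Suc n) = 0")
      case True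
      then show ?thesis using q nonneg[of 0] by simp
    next
      case False
      then have p: "0 < a n" using nonneg[of "Suc n"] dec[of n] by linarith
      have "l * a n * a (Suc n) \<le> l * a n * a n"
        using l nonneg dec by (intro mult_left_mono) auto
      also have "\<dots> \<le> q * (a n - a (Suc n))" using rec[of n] by (simp add: power2_eq_square mult.assoc)
      finally have 1: "a 0 * (l * a n * a (Suc n)) \<le> a 0 * (q * (a n - a (Suc n)))"
        using nonneg by (intro mult_left_mono) auto
      have 2: "a (Suc n) * (a n * (q + l * real n * a 0)) \<le> a (Suc n) * (q * a 0)"
        using Suc.IH nonneg by (intro mult_left_mono) auto
      \<comment> \<open>The sum of \<open>1\<close> and \<open>2\<close>: the terms
        \<open>a 0 * q * a (Suc n)\<close> cancel.\<close>
      have "a n * (a (Suc n) * (q + l * real (Suc n) * a 0)) \<le> a n * (q * a 0)"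
        using 1 2 by (simp add: algebra_simps)
      then show ?thesis using p by simp
    qed
  qed simp
  moreover have "0 < q + l * real n * a 0"
    using q l nonneg[of 0] by (simp add: add_pos_nonneg)
  ultimately show ?thesis by (simp add: pos_le_divide_eq)
qed

lemma max_degree_ge: "degree E i \<le> max_degree (E :: 'v::finite set set)"
  unfolding max_degree_def by (intro Max_ge) auto

lemma max_degree_le_eta_tilde:
  "real (max_degree (union_edges E B (t * B))) \<le> eta_tilde (E :: nat \<Rightarrow> 'v::finite set set) B"
  unfolding eta_tilde_def
proof (rule cSup_upper)
  have "max_degree F \<le> CARD('v)" for F :: "'v set set"
    unfolding max_degree_def degree_def by (subst Max_le_iff) (auto intro: card_mono)
  then show "bdd_above {real (max_degree (union_edges E B (t * B))) |t. True}"
    by (intro bdd_aboveI[of _ "real CARD('v)"]) auto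
qed auto

lemma eta_tilde_nonneg: "0 \<le> eta_tilde (E :: nat \<Rightarrow> 'v::finite set set) B"
  using max_degree_le_eta_tilde[of E B 0] by (meson of_nat_0_le_iff order_trans)

text \<open>Nonnegativity of each eigenvalue bounds the family below, so the real \<open>Inf\<close>
  is a genuine lower bound for every window.\<close>

lemma lambda_low_bounds:
  fixes E :: "nat \<Rightarrow> 'v::finite set set"
  assumes loopfree: "\<And>k i. i \<notin> nbrs (E k) i" and conn: "\<And>k. graph_connected (union_edges E B k)"
    and two: "CARD('v) \<ge> 2"
  shows lambda_low_nonneg: "0 \<le> lambda_low E B"
    and lambda_low_le: "lambda_low E B \<le> lambda_min_nz (laplacian (union_edges E B (t * B)))"
proof -
  have "i \<notin> nbrs (union_edges E B k) i" for k i
    using loopfree unfolding nbrs_def union_edges_def by auto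
  then have nn: "0 \<le> lambda_min_nz (laplacian (union_edges E B k))" for k
    using lambda_min_nz_laplacian_nonneg[OF _ conn two] by blast
  show "0 \<le> lambda_low E B"
    unfolding lambda_low_def using nn by (intro cInf_greatest) auto
  show "lambda_low E B \<le> lambda_min_nz (laplacian (union_edges E B (t * B)))"
    unfolding lambda_low_def using nn by (intro cInf_lower bdd_belowI[of _ 0]) auto
qed

section \<open>Conservation and descent for averaged pairwise steps\<close>

text \<open>\<open>p k i j\<close> stands for the half step of agent \<open>i\<close> on the edge to
  \<open>j\<close>. The Anderson step is abstracted to conservation of the pair sum and two lower
  bounds on the same drop of \<open>d i + d j\<close>.\<close>

locale pairwise_averaging = dual_problem d g \<mu>
  for d :: "'v::finite \<Rightarrow> 'a::euclidean_space \<Rightarrow> real" and g \<mu> +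
  fixes E :: "nat \<Rightarrow> 'v set set" and h :: "nat \<Rightarrow> 'v \<Rightarrow> 'v \<Rightarrow> real"
    and w :: "nat \<Rightarrow> 'v \<Rightarrow> 'a" and p :: "nat \<Rightarrow> 'v \<Rightarrow> 'v \<Rightarrow> 'a" and \<theta>1 \<theta>2 :: real
  assumes loopfree: "\<And>k i. i \<notin> nbrs (E k) i"
    and h_sym: "\<And>k i j. {i, j} \<in> E k \<Longrightarrow> h k i j = h k j i"
    and h_pos: "\<And>k i j. {i, j} \<in> E k \<Longrightarrow> 0 < h k i j"
    and h_sum: "\<And>k i. (\<Sum>j\<in>nbrs (E k) i. h k i j) \<le> 1"
    and h_low_pos: "0 < h_low E h"
    and theta_pos: "0 < \<theta>1" "0 < \<theta>2"
    and pair_sum: "\<And>k i j. {i, j} \<in> E k \<Longrightarrow> p k i j + p k j i = w k i + w k j"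
    and pair_decrease_grad: "\<And>k i j. {i, j} \<in> E k \<Longrightarrow>
      \<theta>1 * (norm (g i (w k i) - g j (w k j)))\<^sup>2
        \<le> d i (w k i) + d j (w k j) - d i (p k i j) - d j (p k j i)"
    and pair_decrease_step: "\<And>k i j. {i, j} \<in> E k \<Longrightarrow>
      \<theta>2 * ((norm (p k i j - w k i))\<^sup>2 + (norm (p k j i - w k j))\<^sup>2)
        \<le> d i (w k i) + d j (w k j) - d i (p k i j) - d j (p k j i)"
    and sum_init: "(\<Sum>i\<in>UNIV. w 0 i) = 0"
    and step: "\<And>k i. w (Suc k) i = (1 - (\<Sum>j\<in>nbrs (E k) i. h k i j)) *\<^sub>R w k i
      + (\<Sum>j\<in>nbrs (E k) i. h k i j *\<^sub>R p k i j)"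
begin

lemma nbrsD: "j \<in> nbrs (E k) i \<Longrightarrow> {i, j} \<in> E k"
  unfolding nbrs_def by simp

lemma step_increment: "w (Suc k) i - w k i = (\<Sum>j\<in>nbrs (E k) i. h k i j *\<^sub>R (p k i j - w k i))"
  unfolding step by (simp add: algebra_simps sum_subtractf scaleR_sum_left)

text \<open>Pairs the contributions of both ends of an edge, which share one weight. The
  vector-valued form covers both iterates and real values.\<close>

lemma sum_weighted_symmetrize:
  fixes \<phi> :: "'v \<Rightarrow> 'v \<Rightarrow> 'b::real_vector"
  shows "(\<Sum>i\<in>UNIV. \<Sum>j\<in>nbrs (E k) i. h k i j *\<^sub>R \<phi> i j)
    = (1 / 2) *\<^sub>R (\<Sum>i\<in>UNIV. \<Sum>j\<in>nbrs (E k) i. h k i j *\<^sub>R (\<phi> i j + \<phi> j i))"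
proof -
  define S where "S = (\<Sum>i\<in>UNIV. \<Sum>j\<in>nbrs (E k) i. h k i j *\<^sub>R \<phi> i j)"
  have "S = (\<Sum>i\<in>UNIV. \<Sum>j\<in>nbrs (E k) i. h k j i *\<^sub>R \<phi> j i)"
    unfolding S_def by (rule sum_nbrs_swap)
  also have "\<dots> = (\<Sum>i\<in>UNIV. \<Sum>j\<in>nbrs (E k) i. h k i j *\<^sub>R \<phi> j i)"
    using h_sym[OF nbrsD] by (intro sum.cong refl) metis
  finally have "S + S = S + (\<Sum>i\<in>UNIV. \<Sum>j\<in>nbrs (E k) i. h k i j *\<^sub>R \<phi> j i)" by simp
  also have "\<dots> = (\<Sum>i\<in>UNIV. \<Sum>j\<in>nbrs (E k) i. h k i j *\<^sub>R (\<phi> i j + \<phi> j i))"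
    unfolding S_def by (simp add: scaleR_add_right sum.distrib)
  finally show ?thesis unfolding S_def[symmetric]
    by (metis (no_types) scaleR_half_double)
qed

text \<open>After symmetrization the increments at the two ends of each edge cancel by
  \<open>pair_sum\<close>.\<close>

lemma sum_zero: "(\<Sum>i\<in>UNIV. w k i) = 0"
proof (induction k)
  case 0 show ?case by (rule sum_init)
next
  case (Suc k)
  have "(\<Sum>i\<in>UNIV. w (Suc k) i) = (\<Sum>i\<in>UNIV. w k i) + (\<Sum>i\<in>UNIV. w (Suc k) i - w k i)"
    by (simp add: sum_subtractf)
  also have "(\<Sum>i\<in>UNIV. w (Suc k) i - w k i) = (1 / 2) *\<^sub>R (\<Sum>i\<in>UNIV. \<Sum>j\<in>nbrs (E k) i.
      h k i j *\<^sub>R (p k i j - w k i + (p k j i - w k j)))"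
    unfolding step_increment by (rule sum_weighted_symmetrize)
  also have "(\<Sum>i\<in>UNIV. \<Sum>j\<in>nbrs (E k) i. h k i j *\<^sub>R (p k i j - w k i + (p k j i - w k j))) = 0"
  proof (intro sum.neutral ballI)
    fix i j assume "j \<in> nbrs (E k) i"
    then have "p k i j + p k j i = w k i + w k j" by (intro pair_sum nbrsD)
    then have "p k i j - w k i + (p k j i - w k j) = 0" by (simp add: algebra_simps)
    then show "h k i j *\<^sub>R (p k i j - w k i + (p k j i - w k j)) = 0" by simp
  qed
  finally show ?case using Suc by simp
qed

text \<open>Jensen via the supporting inequality based at the new iterate: averaging it over the
  points \<open>p k i j\<close> and \<open>w k i\<close> removes the linear term.\<close>

lemma local_convexity:
  "d i (w (Suc k) i) \<le> d i (w k i) + (\<Sum>j\<in>nbrs (E k) i. h k i j * (d i (p k i j) - d i (w k i)))"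
proof -
  define z where "z = w (Suc k) i"
  define H where "H = (\<Sum>j\<in>nbrs (E k) i. h k i j)"
  have sup: "d i z + inner (g i z) (v - z) \<le> d i v" for v
    by (rule cocoercive_grad_supporting[OF mu_pos cocoercive])
  have "(1 - H) * (d i z + inner (g i z) (w k i - z)) \<le> (1 - H) * d i (w k i)"
    using h_sum[of k i] unfolding H_def by (intro mult_left_mono sup) simp
  moreover have "(\<Sum>j\<in>nbrs (E k) i. h k i j * (d i z + inner (g i z) (p k i j - z)))
      \<le> (\<Sum>j\<in>nbrs (E k) i. h k i j * d i (p k i j))"
    using h_pos[OF nbrsD] by (intro sum_mono mult_left_mono sup) (auto intro: less_imp_le)
  moreover have "(1 - H) * (d i z + inner (g i z) (w k i - z))
      + (\<Sum>j\<in>nbrs (E k) i. h k i j * (d i z + inner (g i z) (p k i j - z))) = d i z"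
  proof -
    have "inner (g i z) z = (1 - H) * inner (g i z) (w k i) + (\<Sum>j\<in>nbrs (E k) i. h k i j * inner (g i z) (p k i j))"
      by (subst (2) z_def, unfold step) (simp add: inner_add_right inner_sum_right H_def)
    moreover have "(\<Sum>j\<in>nbrs (E k) i. h k i j * (d i z + inner (g i z) (p k i j - z)))
        = H * (d i z - inner (g i z) z) + (\<Sum>j\<in>nbrs (E k) i. h k i j * inner (g i z) (p k i j))"
      unfolding H_def by (simp add: inner_diff_right algebra_simps sum.distrib sum_subtractf sum_distrib_left sum_distrib_right)
    ultimately show ?thesis by (simp add: inner_diff_right algebra_simps)
  qed
  moreover have "(\<Sum>j\<in>nbrs (E k) i. h k i j * (d i (p k i j) - d i (w k i)))
      = (\<Sum>j\<in>nbrs (E k) i. h k i j * d i (p k i j)) - H * d i (w k i)"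
    unfolding H_def by (simp add: algebra_simps sum_subtractf sum_distrib_left)
  ultimately show ?thesis unfolding z_def[symmetric] by (simp add: algebra_simps)
qed

lemma dual_decrease:
  "1 / 2 * (\<Sum>i\<in>UNIV. \<Sum>j\<in>nbrs (E k) i.
      h k i j * (d i (w k i) + d j (w k j) - d i (p k i j) - d j (p k j i)))
    \<le> Dsum d (w k) - Dsum d (w (Suc k))"
proof -
  have "Dsum d (w (Suc k)) \<le> (\<Sum>i\<in>UNIV. d i (w k i)
      + (\<Sum>j\<in>nbrs (E k) i. h k i j * (d i (p k i j) - d i (w k i))))"
    unfolding Dsum_def by (intro sum_mono local_convexity)
  also have "\<dots> = Dsum d (w k) + (\<Sum>i\<in>UNIV. \<Sum>j\<in>nbrs (E k) i. h k i j *\<^sub>R (d i (p k i j) - d i (w k i)))"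
    unfolding Dsum_def by (simp add: sum.distrib)
  also have "(\<Sum>i\<in>UNIV. \<Sum>j\<in>nbrs (E k) i. h k i j *\<^sub>R (d i (p k i j) - d i (w k i)))
      = (1 / 2) *\<^sub>R (\<Sum>i\<in>UNIV. \<Sum>j\<in>nbrs (E k) i.
          h k i j *\<^sub>R (d i (p k i j) - d i (w k i) + (d j (p k j i) - d j (w k j))))"
    by (rule sum_weighted_symmetrize)
  also have "\<dots> = - (1 / 2 * (\<Sum>i\<in>UNIV. \<Sum>j\<in>nbrs (E k) i.
      h k i j * (d i (w k i) + d j (w k j) - d i (p k i j) - d j (p k j i))))"
    unfolding real_scaleR_def mult_minus_right[symmetric] sum_negf[symmetric]
    by (intro arg_cong[where f = "\<lambda>x. 1 / 2 * x"] sum.cong refl) (simp add: algebra_simps)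
  finally show ?thesis by linarith
qed

text \<open>Jensen bounds the squared move of an agent by the weighted squared half steps, which
  symmetrization turns into the pair displacements of \<open>pair_decrease_step\<close>.\<close>

lemma movement_le_decrease:
  "\<theta>2 * (\<Sum>i\<in>UNIV. (norm (w (Suc k) i - w k i))\<^sup>2) \<le> Dsum d (w k) - Dsum d (w (Suc k))"
proof -
  have "(\<Sum>i\<in>UNIV. (norm (w (Suc k) i - w k i))\<^sup>2)
      \<le> (\<Sum>i\<in>UNIV. \<Sum>j\<in>nbrs (E k) i. h k i j * (norm (p k i j - w k i))\<^sup>2)"
    unfolding step_increment using h_sum h_pos[OF nbrsD]
    by (intro sum_mono norm_weighted_sum_sq_le) (auto intro: less_imp_le)
  also have "\<dots> = 1 / 2 * (\<Sum>i\<in>UNIV. \<Sum>j\<in>nbrs (E k) i.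
      h k i j * ((norm (p k i j - w k i))\<^sup>2 + (norm (p k j i - w k j))\<^sup>2))"
    using sum_weighted_symmetrize[of k "\<lambda>i j. (norm (p k i j - w k i))\<^sup>2"] by simp
  finally have "\<theta>2 * (\<Sum>i\<in>UNIV. (norm (w (Suc k) i - w k i))\<^sup>2)
      \<le> \<theta>2 * (1 / 2 * (\<Sum>i\<in>UNIV. \<Sum>j\<in>nbrs (E k) i.
          h k i j * ((norm (p k i j - w k i))\<^sup>2 + (norm (p k j i - w k j))\<^sup>2)))"
    using theta_pos by simp
  also have "\<dots> = 1 / 2 * (\<Sum>i\<in>UNIV. \<Sum>j\<in>nbrs (E k) i.
      h k i j * (\<theta>2 * ((norm (p k i j - w k i))\<^sup>2 + (norm (p k j i - w k j))\<^sup>2)))"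
    by (simp add: sum_distrib_left mult.left_commute)
  also have "\<dots> \<le> 1 / 2 * (\<Sum>i\<in>UNIV. \<Sum>j\<in>nbrs (E k) i.
      h k i j * (d i (w k i) + d j (w k j) - d i (p k i j) - d j (p k j i)))"
    using h_pos[OF nbrsD]
    by (intro mult_left_mono sum_mono pair_decrease_step nbrsD) (auto intro: less_imp_le)
  also have "\<dots> \<le> Dsum d (w k) - Dsum d (w (Suc k))" by (rule dual_decrease)
  finally show ?thesis .
qed

lemma h_low_le: "{i, j} \<in> E k \<Longrightarrow> h_low E h \<le> h k i j"
  unfolding h_low_def using h_pos
  by (intro cInf_lower bdd_belowI[of _ 0]) (auto intro: less_imp_le)

lemma disagreement_le_decrease:
  "h_low E h * \<theta>1 * (1 / 2 * (\<Sum>i\<in>UNIV. \<Sum>j\<in>nbrs (E k) i. (norm (g i (w k i) - g j (w k j)))\<^sup>2))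
    \<le> Dsum d (w k) - Dsum d (w (Suc k))"
proof -
  have "h_low E h * \<theta>1 * (1 / 2 * (\<Sum>i\<in>UNIV. \<Sum>j\<in>nbrs (E k) i. (norm (g i (w k i) - g j (w k j)))\<^sup>2))
    = 1 / 2 * (\<Sum>i\<in>UNIV. \<Sum>j\<in>nbrs (E k) i. h_low E h * (\<theta>1 * (norm (g i (w k i) - g j (w k j)))\<^sup>2))"
    by (simp add: sum_distrib_left mult.assoc)
  also have "\<dots> \<le> 1 / 2 * (\<Sum>i\<in>UNIV. \<Sum>j\<in>nbrs (E k) i.
      h k i j * (d i (w k i) + d j (w k j) - d i (p k i j) - d j (p k j i)))"
    using theta_pos h_pos[OF nbrsD]
    by (intro mult_left_mono sum_mono mult_mono h_low_le pair_decrease_grad nbrsD) (auto intro: less_imp_le)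
  also have "\<dots> \<le> Dsum d (w k) - Dsum d (w (Suc k))" by (rule dual_decrease)
  finally show ?thesis .
qed

lemma Dsum_antimono: "k \<le> l \<Longrightarrow> Dsum d (w l) \<le> Dsum d (w k)"
proof (rule lift_Suc_antimono_le[of "\<lambda>k. Dsum d (w k)"])
  fix k
  have "0 \<le> \<theta>2 * (\<Sum>i\<in>UNIV. (norm (w (Suc k) i - w k i))\<^sup>2)"
    using theta_pos by (simp add: sum_nonneg)
  then show "Dsum d (w (Suc k)) \<le> Dsum d (w k)" using movement_le_decrease[of k] by linarith
qed

lemma iterates_in_S0set: "w k \<in> S0set d (w 0)"
  unfolding S0set_def using Dsum_antimono[of 0 k] sum_zero by simp

section \<open>Disagreement over a window and the resulting rate\<close>

text \<open>Telescoping, then Cauchy-Schwarz over \<open>B\<close> increments (the factor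
  \<open>real B\<close>), then the Lipschitz bound. Summing over the whole window makes the bound
  independent of \<open>t\<close>.\<close>

lemma gradient_drift:
  assumes "t \<in> {k..<k + B}"
  shows "(norm (g i (w t i) - g i (w k i)))\<^sup>2
    \<le> (1 / \<mu>)\<^sup>2 * (real B * (\<Sum>l\<in>{k..<k + B}. (norm (w (Suc l) i - w l i))\<^sup>2))"
proof -
  have "norm (w t i - w k i) = norm (\<Sum>l\<in>{k..<t}. w (Suc l) i - w l i)"
    using assms by (subst sum_Suc_diff') auto
  also have "\<dots> \<le> (\<Sum>l\<in>{k..<t}. norm (w (Suc l) i - w l i))" by (rule norm_sum)
  also have "\<dots> \<le> (\<Sum>l\<in>{k..<k + B}. norm (w (Suc l) i - w l i))"
    using assms by (intro sum_mono2) auto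
  finally have "(norm (w t i - w k i))\<^sup>2 \<le> (\<Sum>l\<in>{k..<k + B}. norm (w (Suc l) i - w l i))\<^sup>2"
    by (intro power_mono) auto
  also have "\<dots> \<le> real B * (\<Sum>l\<in>{k..<k + B}. (norm (w (Suc l) i - w l i))\<^sup>2)"
    using sum_squared_le_sum_of_squares[of "\<lambda>l. norm (w (Suc l) i - w l i)" "{k..<k + B}"] by (simp add: mult.commute)
  finally have 1: "(norm (w t i - w k i))\<^sup>2 \<le> real B * (\<Sum>l\<in>{k..<k + B}. (norm (w (Suc l) i - w l i))\<^sup>2)" .
  have "(norm (g i (w t i) - g i (w k i)))\<^sup>2 \<le> (1 / \<mu> * norm (w t i - w k i))\<^sup>2"
    by (intro power_mono cocoercive_grad_lipschitz[OF mu_pos cocoercive]) auto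
  also have "\<dots> = (1 / \<mu>)\<^sup>2 * (norm (w t i - w k i))\<^sup>2" by (rule power_mult_distrib)
  also have "\<dots> \<le> (1 / \<mu>)\<^sup>2 * (real B * (\<Sum>l\<in>{k..<k + B}. (norm (w (Suc l) i - w l i))\<^sup>2))"
    using 1 by (intro mult_left_mono) auto
  finally show ?thesis .
qed

text \<open>An edge of the union graph is active at some \<open>t\<close>; the initial difference
  splits into the drift of \<open>i\<close>, the disagreement at \<open>t\<close> and the drift of
  \<open>j\<close>, whence the factor 3.\<close>

lemma window_disagreement_bound:
  assumes eta: "real (max_degree (union_edges E B k)) \<le> \<eta>"
  shows "1 / 2 * (\<Sum>i\<in>UNIV. \<Sum>j\<in>nbrs (union_edges E B k) i. (norm (g i (w k i) - g j (w k j)))\<^sup>2)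
    \<le> (3 * real B * (1 / \<mu>)\<^sup>2 * \<eta> / \<theta>2 + 3 / (h_low E h * \<theta>1)) * (Dsum d (w k) - Dsum d (w (k + B)))"
proof -
  define U where "U = union_edges E B k"
  define I where "I = {k..<k + B}"
  define M where "M i = (1 / \<mu>)\<^sup>2 * (real B * (\<Sum>l\<in>I. (norm (w (Suc l) i - w l i))\<^sup>2))" for i
  \<comment> \<open>Summing over all active times dominates the time picked for each edge, and
    exchanging sums yields the disagreement of each iteration.\<close>
  define G where "G i j = (\<Sum>l\<in>I. if j \<in> nbrs (E l) i then (norm (g i (w l i) - g j (w l j)))\<^sup>2 else 0)" for i j
  have M0: "0 \<le> M i" for i unfolding M_def by (intro mult_nonneg_nonneg sum_nonneg) auto
  have pw: "(norm (g i (w k i) - g j (w k j)))\<^sup>2 \<le> 3 * (M i + G i j + M j)" if edge: "j \<in> nbrs U i" for i j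
  proof -
    obtain t where t: "t \<in> I" "{i, j} \<in> E t"
      using edge unfolding nbrs_def U_def union_edges_def I_def by auto
    have "(norm (g i (w k i) - g j (w k j)))\<^sup>2
        = (norm ((g i (w k i) - g i (w t i)) + (g i (w t i) - g j (w t j)) + (g j (w t j) - g j (w k j))))\<^sup>2"
      by simp
    also have "\<dots> \<le> 3 * ((norm (g i (w k i) - g i (w t i)))\<^sup>2 + (norm (g i (w t i) - g j (w t j)))\<^sup>2
        + (norm (g j (w t j) - g j (w k j)))\<^sup>2)" by (rule norm_add3_sq_le)
    also have "\<dots> \<le> 3 * (M i + G i j + M j)"
    proof (intro mult_left_mono add_mono)
      show "(norm (g i (w k i) - g i (w t i)))\<^sup>2 \<le> M i"
        using gradient_drift[of t k B i] t(1) unfolding M_def I_def by (simp add: norm_minus_commute)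
      show "(norm (g j (w t j) - g j (w k j)))\<^sup>2 \<le> M j"
        using gradient_drift[of t k B j] t(1) unfolding M_def I_def by simp
      have "(norm (g i (w t i) - g j (w t j)))\<^sup>2
          = (if j \<in> nbrs (E t) i then (norm (g i (w t i) - g j (w t j)))\<^sup>2 else 0)"
        using t(2) unfolding nbrs_def by simp
      also have "\<dots> \<le> G i j"
        unfolding G_def by (rule member_le_sum[OF t(1)]) (auto simp: I_def)
      finally show "(norm (g i (w t i) - g j (w t j)))\<^sup>2 \<le> G i j" .
    qed simp
    finally show ?thesis .
  qed
  define \<Delta> where "\<Delta> = Dsum d (w k) - Dsum d (w (k + B))"
  have tele: "(\<Sum>l\<in>I. Dsum d (w l) - Dsum d (w (Suc l))) = \<Delta>"
  proof -
    have "(\<Sum>l\<in>I. - Dsum d (w (Suc l)) - - Dsum d (w l)) = \<Delta>"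
      unfolding I_def \<Delta>_def by (subst sum_Suc_diff'[of k "k + B" "\<lambda>l. - Dsum d (w l)"]) auto
    then show ?thesis by simp
  qed
  have SM: "(\<Sum>i\<in>UNIV. \<Sum>j\<in>nbrs U i. M i) \<le> real B * (1 / \<mu>)\<^sup>2 * \<eta> / \<theta>2 * \<Delta>"
  proof -
    \<comment> \<open>The drift of an agent is counted once per neighbour in the union graph, which
      brings in the maximum degree.\<close>
    have "(\<Sum>i\<in>UNIV. \<Sum>j\<in>nbrs U i. M i) = (\<Sum>i\<in>UNIV. real (degree U i) * M i)"
      by (simp add: degree_def)
    also have "\<dots> \<le> (\<Sum>i\<in>UNIV. \<eta> * M i)"
    proof (intro sum_mono mult_right_mono M0)
      fix i show "real (degree U i) \<le> \<eta>"
        using max_degree_ge[of U i] eta unfolding U_def by linarith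
    qed
    also have "\<dots> = \<eta> * ((1 / \<mu>)\<^sup>2 * (real B * (\<Sum>l\<in>I. \<Sum>i\<in>UNIV. (norm (w (Suc l) i - w l i))\<^sup>2)))"
      unfolding M_def by (subst sum.swap) (simp add: sum_distrib_left)
    also have "\<dots> \<le> \<eta> * ((1 / \<mu>)\<^sup>2 * (real B * (\<Sum>l\<in>I. (Dsum d (w l) - Dsum d (w (Suc l))) / \<theta>2)))"
      using eta movement_le_decrease theta_pos
      by (intro mult_left_mono sum_mono) (auto simp: pos_le_divide_eq mult.commute)
    also have "\<dots> = real B * (1 / \<mu>)\<^sup>2 * \<eta> / \<theta>2 * \<Delta>"
      unfolding sum_divide_distrib[symmetric] tele by simp
    finally show ?thesis .
  qed
  have SG: "1 / 2 * (\<Sum>i\<in>UNIV. \<Sum>j\<in>nbrs U i. G i j) \<le> 1 / (h_low E h * \<theta>1) * \<Delta>"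
  proof -
    have "(\<Sum>i\<in>UNIV. \<Sum>j\<in>nbrs U i. G i j) = (\<Sum>i\<in>UNIV. \<Sum>l\<in>I. \<Sum>j\<in>nbrs U i.
        if j \<in> nbrs (E l) i then (norm (g i (w l i) - g j (w l j)))\<^sup>2 else 0)"
      unfolding G_def by (intro sum.cong refl sum.swap)
    also have "\<dots> = (\<Sum>i\<in>UNIV. \<Sum>l\<in>I. \<Sum>j\<in>nbrs (E l) i. (norm (g i (w l i) - g j (w l j)))\<^sup>2)"
    proof (rule sum.cong[OF refl], rule sum.cong[OF refl])
      fix i l assume "l \<in> I"
      then have "nbrs (E l) i \<subseteq> nbrs U i" unfolding U_def union_edges_def nbrs_def I_def by auto
      then have "nbrs U i \<inter> nbrs (E l) i = nbrs (E l) i" by blast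
      then show "(\<Sum>j\<in>nbrs U i. if j \<in> nbrs (E l) i then (norm (g i (w l i) - g j (w l j)))\<^sup>2 else 0)
          = (\<Sum>j\<in>nbrs (E l) i. (norm (g i (w l i) - g j (w l j)))\<^sup>2)"
        by (simp add: sum.inter_restrict[symmetric])
    qed
    also have "\<dots> = (\<Sum>l\<in>I. \<Sum>i\<in>UNIV. \<Sum>j\<in>nbrs (E l) i. (norm (g i (w l i) - g j (w l j)))\<^sup>2)"
      by (rule sum.swap)
    finally have "1 / 2 * (\<Sum>i\<in>UNIV. \<Sum>j\<in>nbrs U i. G i j)
        = (\<Sum>l\<in>I. 1 / 2 * (\<Sum>i\<in>UNIV. \<Sum>j\<in>nbrs (E l) i. (norm (g i (w l i) - g j (w l j)))\<^sup>2))"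
      by (simp add: sum_distrib_left)
    also have "\<dots> \<le> (\<Sum>l\<in>I. (Dsum d (w l) - Dsum d (w (Suc l))) / (h_low E h * \<theta>1))"
    proof (rule sum_mono)
      fix l
      have "0 < h_low E h * \<theta>1" using theta_pos h_low_pos by simp
      then show "1 / 2 * (\<Sum>i\<in>UNIV. \<Sum>j\<in>nbrs (E l) i. (norm (g i (w l i) - g j (w l j)))\<^sup>2)
          \<le> (Dsum d (w l) - Dsum d (w (Suc l))) / (h_low E h * \<theta>1)"
        using disagreement_le_decrease[of l] by (simp only: pos_le_divide_eq mult.commute)
    qed
    also have "\<dots> = 1 / (h_low E h * \<theta>1) * \<Delta>"
      unfolding sum_divide_distrib[symmetric] tele by simp
    finally show ?thesis .
  qed
  have "(\<Sum>i\<in>UNIV. \<Sum>j\<in>nbrs U i. (norm (g i (w k i) - g j (w k j)))\<^sup>2)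
      \<le> (\<Sum>i\<in>UNIV. \<Sum>j\<in>nbrs U i. 3 * (M i + G i j + M j))"
    by (intro sum_mono pw)
  also have "\<dots> = 3 * ((\<Sum>i\<in>UNIV. \<Sum>j\<in>nbrs U i. M i) + (\<Sum>i\<in>UNIV. \<Sum>j\<in>nbrs U i. G i j)
      + (\<Sum>i\<in>UNIV. \<Sum>j\<in>nbrs U i. M j))"
    by (simp only: distrib_left sum.distrib sum_distrib_left)
  also have "(\<Sum>i\<in>UNIV. \<Sum>j\<in>nbrs U i. M j) = (\<Sum>i\<in>UNIV. \<Sum>j\<in>nbrs U i. M i)"
    by (rule sum_nbrs_swap)
  \<comment> \<open>Both ends contribute the same drift total, so halving leaves one copy of it,
    while \<open>G\<close> keeps its 1/2.\<close>
  finally have "1 / 2 * (\<Sum>i\<in>UNIV. \<Sum>j\<in>nbrs U i. (norm (g i (w k i) - g j (w k j)))\<^sup>2)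
      \<le> 3 * (\<Sum>i\<in>UNIV. \<Sum>j\<in>nbrs U i. M i) + 3 * (1 / 2 * (\<Sum>i\<in>UNIV. \<Sum>j\<in>nbrs U i. G i j))"
    by simp
  also have "\<dots> \<le> 3 * (real B * (1 / \<mu>)\<^sup>2 * \<eta> / \<theta>2 * \<Delta>) + 3 * (1 / (h_low E h * \<theta>1) * \<Delta>)"
    by (intro add_mono mult_left_mono SM SG) auto
  also have "\<dots> = (3 * real B * (1 / \<mu>)\<^sup>2 * \<eta> / \<theta>2 + 3 / (h_low E h * \<theta>1)) * \<Delta>"
    by (simp add: distrib_right)
  finally show ?thesis unfolding U_def \<Delta>_def .
qed

theorem dual_convergence_rate:
  assumes B: "B \<ge> 1" and conn: "\<And>k. graph_connected (union_edges E B k)"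
  defines "\<tau> \<equiv> 3 * real B * (1 / \<mu>)\<^sup>2 * eta_tilde E B / \<theta>2 + 3 / (h_low E h * \<theta>1)"
  shows "Dsum d (w k) - Dstar d \<le> \<tau> * (R0 d (w 0))\<^sup>2 * (Dsum d (w 0) - Dstar d)
    / (\<tau> * (R0 d (w 0))\<^sup>2 + lambda_low E B * real (k div B) * (Dsum d (w 0) - Dstar d))"
proof (cases "Dsum d (w 0) - Dstar d = 0")
  \<comment> \<open>The right-hand side is 0 here and monotonicity suffices; elsewhere a positive
    gap excludes the degenerate situations below.\<close>
  case True
  then show ?thesis using Dsum_antimono[of 0 k] by simp
next
  case False
  define R where "R = R0 d (w 0)"
  obtain u where u: "(\<Sum>i\<in>UNIV. u i) = 0" "\<And>v. (\<Sum>i\<in>UNIV. v i) = 0 \<Longrightarrow> Dsum d u \<le> Dsum d v"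
    using dual_optimum_exists by blast
  have Du: "Dstar d = Dsum d u" using u by (rule Dstar_eq_optimum)
  \<comment> \<open>A single vertex has no nonzero Laplacian eigenvalue, so
    \<open>lambda_min_nz\<close> would be the \<open>Inf\<close> of an empty set. The zero-sum
    constraint then forces \<open>w 0 = u\<close>, contradicting the positive gap.\<close>
  have two: "CARD('v) \<ge> 2"
  proof (rule ccontr)
    assume "\<not> CARD('v) \<ge> 2"
    then have "CARD('v) = 1" using zero_less_card_finite[where 'a='v] by linarith
    then obtain a where a: "(UNIV :: 'v set) = {a}" by (auto simp: card_1_singleton_iff)
    have "v = (\<lambda>_. 0)" if "(\<Sum>i\<in>UNIV. v i) = 0" for v :: "'v \<Rightarrow> 'a"
    proof
      fix i :: 'v
      have "i = a" using a by auto
      then show "v i = 0" using that[unfolded a] by simp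
    qed
    then have "w 0 = u" using u(1) sum_init by metis
    then show False using False Du by simp
  qed
  \<comment> \<open>\<open>R = 0\<close> would make the gap bound vanish; positivity of
    \<open>\<tau> * R\<^sup>2\<close> is required by \<open>quadratic_decrease_rate\<close>.\<close>
  have "R \<noteq> 0"
  proof
    assume "R = 0"
    then have "Dsum d (w 0) - Dstar d \<le> 0"
      using dual_gap_bound[OF iterates_in_S0set[of 0], of 0] unfolding R_def by simp
    moreover have "Dstar d \<le> Dsum d (w 0)" using u(2)[OF sum_init] Du by simp
    ultimately show False using False by simp
  qed
  moreover have tau: "\<tau> > 0"
    unfolding \<tau>_def using theta_pos h_low_pos mu_pos eta_tilde_nonneg[of E B]
    by (intro add_nonneg_pos divide_nonneg_pos mult_nonneg_nonneg divide_pos_pos mult_pos_pos) auto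
  ultimately have q: "0 < \<tau> * R\<^sup>2" by simp
  define a where "a t = Dsum d (w (t * B)) - Dstar d" for t
  have rec: "lambda_low E B * (a t)\<^sup>2 \<le> \<tau> * R\<^sup>2 * (a t - a (Suc t))" for t
  proof -
    define k where "k = t * B"
    define U where "U = union_edges E B k"
    define c where "c = (1 / real CARD('v)) *\<^sub>R (\<Sum>i\<in>UNIV. g i (w k i))"
    define P where "P = pnorm (\<lambda>i. g i (w k i) - c)"
    have lfU: "i \<notin> nbrs U i" for i
      using loopfree unfolding U_def nbrs_def union_edges_def by auto
    have a0: "0 \<le> a t" unfolding a_def Du using u(2)[OF sum_zero] by simp
    have "a t \<le> R * P" unfolding a_def R_def P_def k_def[symmetric] by (rule dual_gap_bound[OF iterates_in_S0set])
    then have "(a t)\<^sup>2 \<le> R\<^sup>2 * P\<^sup>2"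
      using a0 by (metis power_mono power_mult_distrib)
    then have "lambda_low E B * (a t)\<^sup>2 \<le> lambda_low E B * (R\<^sup>2 * P\<^sup>2)"
      by (intro mult_left_mono lambda_low_nonneg[OF loopfree conn two])
    also have "\<dots> = R\<^sup>2 * (lambda_low E B * P\<^sup>2)" by simp
    also have "\<dots> \<le> R\<^sup>2 * (\<tau> * (a t - a (Suc t)))"
    proof (rule mult_left_mono)
      have "lambda_low E B * P\<^sup>2 \<le> lambda_min_nz (laplacian U) * P\<^sup>2"
        unfolding U_def k_def by (intro mult_right_mono lambda_low_le[OF loopfree conn two]) auto
      also have "\<dots> \<le> 1 / 2 * (\<Sum>i\<in>UNIV. \<Sum>j\<in>nbrs U i. (norm (g i (w k i) - g j (w k j)))\<^sup>2)"
        unfolding P_def c_def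
        by (rule spectral_gap_deviation_from_mean[OF lfU _ two]) (simp add: U_def conn)
      also have "\<dots> \<le> \<tau> * (Dsum d (w k) - Dsum d (w (k + B)))"
        unfolding U_def \<tau>_def
        by (rule window_disagreement_bound) (simp add: k_def max_degree_le_eta_tilde)
      also have "\<dots> = \<tau> * (a t - a (Suc t))" unfolding a_def k_def by (simp add: add.commute)
      finally show "lambda_low E B * P\<^sup>2 \<le> \<tau> * (a t - a (Suc t))" .
    qed simp
    finally show ?thesis by (simp add: ac_simps)
  qed
  have "a (k div B) \<le> \<tau> * R\<^sup>2 * a 0 / (\<tau> * R\<^sup>2 + lambda_low E B * real (k div B) * a 0)"
  proof (rule quadratic_decrease_rate[where a = a, OF _ _ _ q rec])
    show "0 \<le> lambda_low E B" by (rule lambda_low_nonneg[OF loopfree conn two])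
    show "0 \<le> a n" for n unfolding a_def Du using u(2)[OF sum_zero] by simp
    show "a (Suc n) \<le> a n" for n unfolding a_def by (simp add: Dsum_antimono)
  qed
  \<comment> \<open>\<open>a\<close> samples only multiples of \<open>B\<close>; monotonicity covers
    the remaining \<open>k mod B\<close> iterations.\<close>
  moreover have "Dsum d (w k) - Dstar d \<le> a (k div B)"
    unfolding a_def by (simp add: Dsum_antimono)
  ultimately show ?thesis unfolding a_def R_def by simp
qed

end

section \<open>Safeguarded Anderson steps and primal recovery\<close>

lemma mem_idx_commute: "mem_idx E m k i j = mem_idx E m k j i"
  unfolding mem_idx_def by (simp add: insert_commute)

text \<open>\<open>p\<close> and \<open>q\<close> are the half steps at the two ends of an edge.
  Feasibility of the coefficients gives conservation; decrease comes from the safeguard when it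
  accepts, otherwise from a plain gradient step.\<close>

lemma (in dual_problem) half_step_pair:
  fixes w :: "nat \<Rightarrow> 'v \<Rightarrow> 'a"
    and c1 c2 :: real and s :: bool
  assumes L: "L = 1 / \<mu>" and beta: "0 < \<beta>" "\<beta> < 1 / L"
    and feas: "aa_feasible E m w k i j a b"
  defines "p \<equiv> half_step s L \<beta> c1 c2 E m d g w k i j a b"
    and "q \<equiv> half_step s L \<beta> c1 c2 E m d g w k j i b a"
    and "decr \<equiv> \<lambda>p q. d i (w k i) + d j (w k j) - d i p - d j q"
  shows half_step_pair_sum: "p + q = w k i + w k j"
    and half_step_decrease_grad: "min (\<beta> * (1 - \<beta> * L)) c1 * (norm (g i (w k i) - g j (w k j)))\<^sup>2 \<le> decr p q"
    and half_step_decrease_step: "min ((1 / \<beta> - L) / 2) c2 * ((norm (p - w k i))\<^sup>2 + (norm (q - w k j))\<^sup>2) \<le> decr p q"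
proof -
  define I where "I = mem_idx E m k i j"
  define D where "D = Dcomb g w I i a - Dcomb g w I j b"
  define P where "P = Wcomb w I i a - \<beta> *\<^sub>R D"
  define Q where "Q = Wcomb w I j b + \<beta> *\<^sub>R D"
  define G where "G = g i (w k i) - g j (w k j)"
  define \<rho> where "\<rho> = min (- c1 * (norm G)\<^sup>2) (- c2 * ((norm (P - w k i))\<^sup>2 + (norm (Q - w k j))\<^sup>2))"
  define T where "T = (if s then d i P + d j Q - d i (w k i) - d j (w k j) \<le> \<rho>
    else inner (g i (w k i)) (P - w k i) + L / 2 * (norm (P - w k i))\<^sup>2
      + inner (g j (w k j)) (Q - w k j) + L / 2 * (norm (Q - w k j))\<^sup>2 \<le> \<rho>)"
  have p: "p = (if T then P else w k i - \<beta> *\<^sub>R G)"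
    unfolding p_def half_step_def Let_def T_def \<rho>_def P_def Q_def G_def D_def I_def
    by (simp add: algebra_simps)
  \<comment> \<open>\<open>q\<close> is defined by a test of its own with the roles exchanged; it
    has to coincide with \<open>T\<close>, so that both ends take the same branch.\<close>
  have q: "q = (if T then Q else w k j + \<beta> *\<^sub>R G)"
  proof -
    have Q': "Wcomb w I j b - \<beta> *\<^sub>R (Dcomb g w I j b - Dcomb g w I i a) = Q"
      and P': "Wcomb w I i a - \<beta> *\<^sub>R (Dcomb g w I i a - Dcomb g w I j b) = P"
      unfolding P_def Q_def D_def by (simp_all add: algebra_simps)
    have \<rho>': "min (- c1 * (norm (g j (w k j) - g i (w k i)))\<^sup>2)
        (- c2 * ((norm (Q - w k j))\<^sup>2 + (norm (P - w k i))\<^sup>2)) = \<rho>"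
      unfolding \<rho>_def G_def by (simp add: norm_minus_commute add.commute)
    have "(if s then d j Q + d i P - d j (w k j) - d i (w k i) \<le> \<rho>
      else inner (g j (w k j)) (Q - w k j) + L / 2 * (norm (Q - w k j))\<^sup>2
        + inner (g i (w k i)) (P - w k i) + L / 2 * (norm (P - w k i))\<^sup>2 \<le> \<rho>) = T"
      unfolding T_def by (auto simp: algebra_simps)
    then show ?thesis
      unfolding q_def half_step_def Let_def mem_idx_commute[of E m k j i] I_def[symmetric] Q' P' \<rho>'
      by (simp add: G_def algebra_simps)
  qed
  have PQ: "P + Q = w k i + w k j"
    using feas unfolding aa_feasible_def Let_def P_def Q_def I_def by simp
  then show "p + q = w k i + w k j" unfolding p q by simp
  have desc: "d i u \<le> d i z + inner (g i z) (u - z) + L / 2 * (norm (u - z))\<^sup>2" for i u z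
    unfolding L by (rule cocoercive_grad_descent[OF mu_pos cocoercive])
  have "min (\<beta> * (1 - \<beta> * L)) c1 * (norm G)\<^sup>2 \<le> decr p q
    \<and> min ((1 / \<beta> - L) / 2) c2 * ((norm (p - w k i))\<^sup>2 + (norm (q - w k j))\<^sup>2) \<le> decr p q"
  proof (cases T)
    case True
    \<comment> \<open>The quantity tested in (S2) bounds the change of \<open>d i + d j\<close> from
      above by the descent inequality, so both tests imply this.\<close>
    have "- decr P Q \<le> \<rho>"
      using True desc[of i P "w k i"] desc[of j Q "w k j"] unfolding T_def decr_def
      by (auto split: if_splits)
    then have "c1 * (norm G)\<^sup>2 \<le> decr P Q"
      "c2 * ((norm (P - w k i))\<^sup>2 + (norm (Q - w k j))\<^sup>2) \<le> decr P Q"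
      unfolding \<rho>_def by auto
    moreover have "min (\<beta> * (1 - \<beta> * L)) c1 * (norm G)\<^sup>2 \<le> c1 * (norm G)\<^sup>2"
      by (intro mult_right_mono) auto
    moreover have "min ((1 / \<beta> - L) / 2) c2 * ((norm (P - w k i))\<^sup>2 + (norm (Q - w k j))\<^sup>2)
        \<le> c2 * ((norm (P - w k i))\<^sup>2 + (norm (Q - w k j))\<^sup>2)"
      by (intro mult_right_mono) auto
    ultimately show ?thesis using True unfolding p q by simp
  next
    case False
    have eq: "p = w k i - \<beta> *\<^sub>R G" "q = w k j + \<beta> *\<^sub>R G" using False p q by simp_all
    have n: "(norm (p - w k i))\<^sup>2 = \<beta>\<^sup>2 * (norm G)\<^sup>2" "(norm (q - w k j))\<^sup>2 = \<beta>\<^sup>2 * (norm G)\<^sup>2"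
      unfolding eq by (simp_all add: power_mult_distrib)
    have "d i p \<le> d i (w k i) - \<beta> * inner (g i (w k i)) G + L / 2 * (\<beta>\<^sup>2 * (norm G)\<^sup>2)"
      using desc[of i p "w k i"] unfolding n unfolding eq by simp
    moreover have "d j q \<le> d j (w k j) + \<beta> * inner (g j (w k j)) G + L / 2 * (\<beta>\<^sup>2 * (norm G)\<^sup>2)"
      using desc[of j q "w k j"] unfolding n unfolding eq by simp
    moreover have "inner (g i (w k i)) G = inner (g j (w k j)) G + (norm G)\<^sup>2"
      unfolding G_def power2_norm_eq_inner by (simp add: inner_diff_left)
    ultimately have dec: "\<beta> * (1 - \<beta> * L) * (norm G)\<^sup>2 \<le> decr p q"
      unfolding decr_def by (simp add: algebra_simps power2_eq_square)
    have "min (\<beta> * (1 - \<beta> * L)) c1 * (norm G)\<^sup>2 \<le> \<beta> * (1 - \<beta> * L) * (norm G)\<^sup>2"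
      by (intro mult_right_mono) auto
    moreover have "min ((1 / \<beta> - L) / 2) c2 * ((norm (p - w k i))\<^sup>2 + (norm (q - w k j))\<^sup>2)
        \<le> (1 / \<beta> - L) / 2 * ((norm (p - w k i))\<^sup>2 + (norm (q - w k j))\<^sup>2)"
      by (intro mult_right_mono min.cobounded1) simp
    \<comment> \<open>The displacements total \<open>2 * \<beta>\<^sup>2\<close> times the squared
      norm of \<open>G\<close>; this is the origin of the constant
      \<open>(1 / \<beta> - L) / 2\<close>.\<close>
    moreover have "(1 / \<beta> - L) / 2 * ((norm (p - w k i))\<^sup>2 + (norm (q - w k j))\<^sup>2)
        = \<beta> * (1 - \<beta> * L) * (norm G)\<^sup>2"
      unfolding n using beta(1) by (simp add: field_simps power2_eq_square)
    ultimately show ?thesis using dec by linarith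
  qed
  then show "min (\<beta> * (1 - \<beta> * L)) c1 * (norm (g i (w k i) - g j (w k j)))\<^sup>2 \<le> decr p q"
    "min ((1 / \<beta> - L) / 2) c2 * ((norm (p - w k i))\<^sup>2 + (norm (q - w k j))\<^sup>2) \<le> decr p q"
    unfolding G_def by auto
qed

section \<open>Coercivity of the dual objective\<close>

lemma fenchel_young:
  fixes f :: "'a::euclidean_space \<Rightarrow> ereal"
  assumes "\<mu> > 0" "proper_fun f" "lsc_fun f" "strongly_convex_fun \<mu> f" "y \<in> edom f"
  shows "inner w y - real_of_ereal (f y) \<le> conj_fun f w"
proof -
  have "0 \<le> \<mu> / 2 * (norm (y - grad (conj_fun f) w))\<^sup>2" using assms(1) by simp
  then show ?thesis
    using strong_subgradient[OF assms(1-4) assms(5), of w] fenchel_equality[OF assms(1-4), of w]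
    by (simp add: inner_diff_right)
qed

text \<open>A finite convex function is continuous on an open set in finite dimension, hence bounded
  on a compact ball.\<close>

lemma strongly_convex_fun_bounded_above_cball:
  fixes f :: "'a::euclidean_space \<Rightarrow> ereal"
  assumes mu: "\<mu> > 0" and sc: "strongly_convex_fun \<mu> f" and sub: "cball x r \<subseteq> interior (edom f)"
  shows "\<exists>C. \<forall>y\<in>cball x r. real_of_ereal (f y) \<le> C"
proof -
  have "convex_on (edom f) (\<lambda>x. real_of_ereal (f x))"
  proof (rule convex_onI)
    fix t :: real and x y assume t: "0 < t" "t < 1" and xy: "x \<in> edom f" "y \<in> edom f"
    have "0 \<le> \<mu> / 2 * (t * (1 - t) * (norm (x - y))\<^sup>2)" using mu t by simp
    then show "real_of_ereal (f ((1 - t) *\<^sub>R x + t *\<^sub>R y))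
        \<le> (1 - t) * real_of_ereal (f x) + t * real_of_ereal (f y)"
      using strongly_convex_funD(2)[OF sc xy, of t] t by linarith
  qed (use sc in \<open>simp add: strongly_convex_fun_def\<close>)
  then have "convex_on (interior (edom f)) (\<lambda>x. real_of_ereal (f x))"
    using sc unfolding strongly_convex_fun_def
    by (meson convex_interior convex_on_subset interior_subset)
  then have "continuous_on (interior (edom f)) (\<lambda>x. real_of_ereal (f x))"
    by (intro convex_on_continuous) auto
  then have "continuous_on (cball x r) (\<lambda>x. real_of_ereal (f x))"
    using sub by (rule continuous_on_subset)
  then have "bdd_above ((\<lambda>x. real_of_ereal (f x)) ` cball x r)"
    by (intro bounded_imp_bdd_above compact_imp_bounded compact_continuous_image compact_cball)
  then show ?thesis unfolding bdd_above_def by auto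
qed

text \<open>Fenchel-Young at points of a ball inside all domains gives each conjugate linear growth
  \<open>r\<close>. The terms \<open>inner (u i) x\<close> cancel because the centre
  \<open>x\<close> is common and the \<open>u i\<close> sum to zero.\<close>

lemma conj_fun_sum_growth:
  fixes f :: "'v::finite \<Rightarrow> 'a::euclidean_space \<Rightarrow> ereal"
  assumes mu: "\<mu> > 0" and pr: "\<And>i. proper_fun (f i)" and lsc: "\<And>i. lsc_fun (f i)"
    and sc: "\<And>i. strongly_convex_fun \<mu> (f i)" and int: "interior (\<Inter>i. edom (f i)) \<noteq> {}"
  shows "\<exists>r>0. \<exists>C. \<forall>u. (\<Sum>i\<in>UNIV. u i) = 0 \<longrightarrow>
    r * (\<Sum>i\<in>UNIV. norm (u i)) \<le> Dsum (\<lambda>i. conj_fun (f i)) u + C"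
proof -
  obtain x where "x \<in> interior (\<Inter>i. edom (f i))" using int by blast
  then obtain r where r: "r > 0" "cball x r \<subseteq> interior (\<Inter>i. edom (f i))"
    using open_contains_cball open_interior by blast
  have sub: "cball x r \<subseteq> interior (edom (f i))" for i
    using r(2) interior_mono[of "\<Inter>i. edom (f i)" "edom (f i)"] by blast
  obtain C where C: "\<And>i y. y \<in> cball x r \<Longrightarrow> real_of_ereal (f i y) \<le> C i"
    using strongly_convex_fun_bounded_above_cball[OF mu sc sub] by metis
  have loc: "inner (u i) x + r * norm (u i) - C i \<le> conj_fun (f i) (u i)" for u i
  proof -
    \<comment> \<open>Maximizes \<open>inner (u i)\<close> over the ball; \<open>sgn 0 = 0\<close>
      covers \<open>u i = 0\<close>.\<close>
    define y where "y = x + r *\<^sub>R sgn (u i)"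
    have y: "y \<in> cball x r" unfolding y_def using r(1) by (simp add: dist_norm norm_sgn)
    then have "y \<in> edom (f i)" using sub interior_subset by blast
    then have "inner (u i) y - real_of_ereal (f i y) \<le> conj_fun (f i) (u i)"
      by (rule fenchel_young[OF mu pr lsc sc])
    moreover have "inner (u i) y = inner (u i) x + r * norm (u i)"
      unfolding y_def sgn_div_norm by (cases "u i = 0") (simp_all add: inner_add_right power2_norm_eq_inner[symmetric] power2_eq_square)
    ultimately show ?thesis using C[OF y, of i] by linarith
  qed
  have "r * (\<Sum>i\<in>UNIV. norm (u i)) \<le> Dsum (\<lambda>i. conj_fun (f i)) u + (\<Sum>i\<in>UNIV. C i)"
    if u: "(\<Sum>i\<in>UNIV. u i) = 0" for u
  proof -
    have "(\<Sum>i\<in>UNIV. inner (u i) x + r * norm (u i) - C i) \<le> Dsum (\<lambda>i. conj_fun (f i)) u"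
      unfolding Dsum_def by (intro sum_mono loc)
    moreover have "(\<Sum>i\<in>UNIV. inner (u i) x) = 0"
      unfolding inner_sum_left[symmetric] u by simp
    ultimately show ?thesis by (simp add: sum.distrib sum_subtractf sum_distrib_left)
  qed
  then show ?thesis using r(1) by blast
qed

section \<open>Primal optimum and primal error bounds\<close>

text \<open>Summing the strong subgradient inequalities at \<open>c\<close> cancels the linear
  terms. The remaining quadratic term makes the minimizer unique, as the description in
  \<open>xstar\<close> demands.\<close>

lemma primal_optimum_from_dual:
  fixes f :: "'v::finite \<Rightarrow> 'a::euclidean_space \<Rightarrow> ereal"
  assumes mu: "\<mu> > 0" and pr: "\<And>i. proper_fun (f i)" and lsc: "\<And>i. lsc_fun (f i)"
    and sc: "\<And>i. strongly_convex_fun \<mu> (f i)"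
    and u: "(\<Sum>i\<in>UNIV. u i) = 0" and c: "\<And>i. grad (conj_fun (f i)) (u i) = c"
  shows xstar_from_dual: "xstar f = c"
    and Fstar_from_dual: "Fstar f = (\<Sum>i\<in>UNIV. real_of_ereal (f i c))"
proof -
  define F where "F i y = real_of_ereal (f i y)" for i y
  have cd: "c \<in> edom (f i)" for i
    using grad_conj_fun_in_edom[OF mu pr lsc sc, of i "u i"] c by simp
  have fF: "f i y = ereal (F i y)" if "y \<in> edom (f i)" for i y
    using proper_fun_ereal_real[OF pr that] unfolding F_def by simp
  have fc: "(\<Sum>i\<in>UNIV. f i c) = ereal (\<Sum>i\<in>UNIV. F i c)"
    using fF[OF cd] by simp
  have low: "ereal ((\<Sum>i\<in>UNIV. F i c) + real CARD('v) * (\<mu> / 2 * (norm (y - c))\<^sup>2)) \<le> (\<Sum>i\<in>UNIV. f i y)" for y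
  proof (cases "\<forall>i. y \<in> edom (f i)")
    case True
    have "(\<Sum>i\<in>UNIV. F i c + inner (u i) (y - c) + \<mu> / 2 * (norm (y - c))\<^sup>2) \<le> (\<Sum>i\<in>UNIV. F i y)"
      unfolding F_def using strong_subgradient[OF mu pr lsc sc, of y _ "u _"] True c
      by (intro sum_mono) metis
    moreover have "(\<Sum>i\<in>UNIV. inner (u i) (y - c)) = 0"
      unfolding inner_sum_left[symmetric] u by simp
    ultimately have "(\<Sum>i\<in>UNIV. F i c) + real CARD('v) * (\<mu> / 2 * (norm (y - c))\<^sup>2) \<le> (\<Sum>i\<in>UNIV. F i y)"
      by (simp add: sum.distrib)
    moreover have "(\<Sum>i\<in>UNIV. f i y) = ereal (\<Sum>i\<in>UNIV. F i y)"
      using fF True by simp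
    ultimately show ?thesis by simp
  next
    case False
    then obtain i where "f i y = \<infinity>" unfolding edom_def by auto
    then have "(\<Sum>i\<in>UNIV. f i y) = \<infinity>" by (subst sum_Pinfty) auto
    then show ?thesis by simp
  qed
  have min: "(\<Sum>i\<in>UNIV. f i c) \<le> (\<Sum>i\<in>UNIV. f i y)" for y
  proof -
    have "ereal (\<Sum>i\<in>UNIV. F i c)
        \<le> ereal ((\<Sum>i\<in>UNIV. F i c) + real CARD('v) * (\<mu> / 2 * (norm (y - c))\<^sup>2))"
      using mu by simp
    then show ?thesis unfolding fc using low[of y] by (rule order_trans)
  qed
  show "xstar f = c" unfolding xstar_def
  proof (rule the_equality)
    fix y assume "\<forall>z. (\<Sum>i\<in>UNIV. f i y) \<le> (\<Sum>i\<in>UNIV. f i z)"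
    then have "(\<Sum>i\<in>UNIV. f i y) \<le> ereal (\<Sum>i\<in>UNIV. F i c)" unfolding fc[symmetric] by blast
    with low[of y] have "ereal ((\<Sum>i\<in>UNIV. F i c) + real CARD('v) * (\<mu> / 2 * (norm (y - c))\<^sup>2))
        \<le> ereal (\<Sum>i\<in>UNIV. F i c)" by (rule order_trans)
    then have "real CARD('v) * (\<mu> / 2 * (norm (y - c))\<^sup>2) \<le> 0" by simp
    then show "y = c" using mu by (simp add: mult_le_0_iff)
  qed (use min in blast)
  have "(INF x. \<Sum>i\<in>UNIV. f i x) = (\<Sum>i\<in>UNIV. f i c)"
    by (rule INF_eqI) (use min in auto)
  then show "Fstar f = (\<Sum>i\<in>UNIV. real_of_ereal (f i c))"
    unfolding Fstar_def fc by (simp add: F_def)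
qed

lemma primal_error_bounds:
  fixes f :: "'v::finite \<Rightarrow> 'a::euclidean_space \<Rightarrow> ereal"
  assumes mu: "\<mu> > 0" and pr: "\<And>i. proper_fun (f i)" and lsc: "\<And>i. lsc_fun (f i)"
    and sc: "\<And>i. strongly_convex_fun \<mu> (f i)" and int: "interior (\<Inter>i. edom (f i)) \<noteq> {}"
  defines "d \<equiv> \<lambda>i. conj_fun (f i)" and "g \<equiv> \<lambda>i. grad (conj_fun (f i))"
  assumes w0: "(\<Sum>i\<in>UNIV. w0 i) = 0" and w: "w \<in> S0set d w0"
  shows primal_distance_bound:
      "pnorm (\<lambda>i. g i (w i) - xstar f) \<le> sqrt (2 * (1 / \<mu>) * (Dsum d w - Dstar d))"
    and primal_value_bound: "\<bar>(\<Sum>i\<in>UNIV. real_of_ereal (f i (g i (w i)))) - Fstar f\<bar>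
      \<le> (R0 d w0 + pnorm w0) * sqrt (2 * (1 / \<mu>) * (Dsum d w - Dstar d))"
proof -
  interpret dual_problem d g \<mu>
    unfolding d_def g_def
    by unfold_locales (use mu conj_fun_cocoercive[OF mu pr lsc sc] conj_fun_sum_growth[OF mu pr lsc sc int] in auto)
  obtain u where u: "(\<Sum>i\<in>UNIV. u i) = 0" "\<And>v. (\<Sum>i\<in>UNIV. v i) = 0 \<Longrightarrow> Dsum d u \<le> Dsum d v"
    using dual_optimum_exists by blast
  have Du: "Dstar d = Dsum d u" using u by (rule Dstar_eq_optimum)
  \<comment> \<open>\<open>undefined\<close> serves as an arbitrary agent, since all gradients at
    the optimum agree.\<close>
  define c where "c = g undefined (u undefined)"
  have c: "g i (u i) = c" for i
    unfolding c_def using u by (rule optimum_gradients_equal)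
  have c': "grad (conj_fun (f i)) (u i) = c" for i using c[of i] unfolding g_def .
  have xs: "xstar f = c" by (rule xstar_from_dual[OF mu pr lsc sc u(1) c'])
  have Fs: "Fstar f = (\<Sum>i\<in>UNIV. real_of_ereal (f i c))"
    by (rule Fstar_from_dual[OF mu pr lsc sc u(1) c'])
  have ws: "(\<Sum>i\<in>UNIV. w i) = 0" using w unfolding S0set_def by simp
  define X where "X = (\<lambda>i. g i (w i) - c)"
  define gap where "gap = Dsum d w - Dstar d"
  have gap0: "0 \<le> gap" unfolding gap_def Du using u(2)[OF ws] by simp
  have inner_c: "(\<Sum>i\<in>UNIV. inner c (v i)) = inner c (\<Sum>i\<in>UNIV. v i)" for v
    by (simp add: inner_sum_right)
  \<comment> \<open>Cocoercivity based at the optimum \<open>u\<close>; its linear term vanishes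
    because the gradients equal \<open>c\<close> and both points sum to zero.\<close>
  have "\<mu> / 2 * (pnorm X)\<^sup>2 \<le> gap"
  proof -
    have "(\<Sum>i\<in>UNIV. inner (g i (u i)) (w i - u i)) = 0"
      unfolding c inner_c using ws u(1) by (simp add: sum_subtractf)
    then show ?thesis using Dsum_cocoercive[of u w] unfolding gap_def Du pnorm_sq X_def c by simp
  qed
  then have "(pnorm X)\<^sup>2 \<le> 2 * (1 / \<mu>) * gap" using mu by (simp add: field_simps)
  then have X: "pnorm X \<le> sqrt (2 * (1 / \<mu>) * gap)" by (rule real_le_rsqrt)
  then show "pnorm (\<lambda>i. g i (w i) - xstar f) \<le> sqrt (2 * (1 / \<mu>) * (Dsum d w - Dstar d))"
    unfolding xs X_def gap_def .
  have w0S: "w0 \<in> S0set d w0" using w0 unfolding S0set_def by simp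
  have uS: "u \<in> S0set d w0" using u w0 unfolding S0set_def by simp
  \<comment> \<open>Used for both \<open>w\<close> (upper estimate of the value error) and
    \<open>u\<close> (lower estimate).\<close>
  have bound: "pnorm v \<le> R0 d w0 + pnorm w0" if "v \<in> S0set d w0" for v
    using pnorm_le_diff_add[of v w0] pnorm_diff_le_R0[OF that w0S] by linarith
  have prod: "pnorm v * pnorm X \<le> (R0 d w0 + pnorm w0) * sqrt (2 * (1 / \<mu>) * gap)" if "v \<in> S0set d w0" for v
    using bound[OF that] X order_trans[OF pnorm_nonneg bound[OF that]]
    by (intro mult_mono) auto
  define Fw where "Fw = (\<Sum>i\<in>UNIV. real_of_ereal (f i (g i (w i))))"
  have eq: "real_of_ereal (f i (g i v)) = inner v (g i v) - d i v" for i v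
    using fenchel_equality[OF mu pr lsc sc, of i v] unfolding d_def g_def by simp
  have "real_of_ereal (f i c) = inner (u i) c - d i (u i)" for i
    using eq[of i "u i"] unfolding c .
  then have "Fstar f = (\<Sum>i\<in>UNIV. inner (u i) c - d i (u i))"
    unfolding Fs by simp
  also have "\<dots> = - Dstar d"
    unfolding Du Dsum_def sum_subtractf inner_sum_left[symmetric] u(1) by simp
  finally have FD: "Fstar f = - Dstar d" .
  \<comment> \<open>Fenchel equality at each \<open>w i\<close> together with \<open>FD\<close>.
    Since the \<open>w i\<close> sum to zero, \<open>c\<close> may be subtracted from the
    gradients.\<close>
  have "Fw - Fstar f = (\<Sum>i\<in>UNIV. inner (w i) (g i (w i))) - gap"
    unfolding Fw_def eq FD gap_def Dsum_def by (simp add: sum_subtractf)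
  also have "(\<Sum>i\<in>UNIV. inner (w i) (g i (w i))) = (\<Sum>i\<in>UNIV. inner (w i) (X i))"
    unfolding X_def inner_diff_right sum_subtractf inner_sum_left[symmetric] ws by simp
  finally have up: "Fw - Fstar f \<le> pnorm w * pnorm X"
    using sum_inner_le_pnorm[of w X] gap0 by linarith
  \<comment> \<open>Lower estimate: \<open>u i\<close> is a subgradient of \<open>f i\<close> at
    \<open>c\<close>, tested at the gradient at \<open>w i\<close>.\<close>
  have "(\<Sum>i\<in>UNIV. real_of_ereal (f i c) + inner (u i) (X i)) \<le> Fw"
    unfolding Fw_def
  proof (rule sum_mono)
    fix i
    have "real_of_ereal (f i c) + inner (u i) (X i) + \<mu> / 2 * (norm (X i))\<^sup>2 \<le> real_of_ereal (f i (g i (w i)))"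
      using strong_subgradient[OF mu pr lsc sc grad_conj_fun_in_edom[OF mu pr lsc sc], of i "u i" "w i"] c[of i]
      unfolding g_def X_def by simp
    moreover have "0 \<le> \<mu> / 2 * (norm (X i))\<^sup>2" using mu by simp
    ultimately show "real_of_ereal (f i c) + inner (u i) (X i) \<le> real_of_ereal (f i (g i (w i)))"
      by linarith
  qed
  then have lo: "- (pnorm u * pnorm X) \<le> Fw - Fstar f"
    using sum_inner_le_pnorm[of u X] unfolding Fs sum.distrib by linarith
  show "\<bar>(\<Sum>i\<in>UNIV. real_of_ereal (f i (g i (w i)))) - Fstar f\<bar>
      \<le> (R0 d w0 + pnorm w0) * sqrt (2 * (1 / \<mu>) * (Dsum d w - Dstar d))"
    using up lo prod[OF w] prod[OF uS] unfolding Fw_def gap_def by linarith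
qed

section \<open>The algorithm as a pairwise averaging scheme\<close>

theorem theorem1:
  fixes f :: "'v::finite \<Rightarrow> 'a::euclidean_space \<Rightarrow> ereal"
    and \<mu> \<beta> c1 c2 :: real and m B :: nat and s :: bool
    and E :: "nat \<Rightarrow> 'v set set" and h :: "nat \<Rightarrow> 'v \<Rightarrow> 'v \<Rightarrow> real"
    and w :: "nat \<Rightarrow> 'v \<Rightarrow> 'a" and al :: "nat \<Rightarrow> 'v \<Rightarrow> 'v \<Rightarrow> nat \<Rightarrow> real"
  defines "L \<equiv> 1 / \<mu>"
    and "dc \<equiv> (\<lambda>i. conj_fun (f i))"
    and "dg \<equiv> (\<lambda>i. grad (conj_fun (f i)))"
  assumes mu_pos: "\<mu> > 0"
    and f_proper: "\<And>i. proper_fun (f i)"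
    and f_lsc: "\<And>i. lsc_fun (f i)"
    and f_sconv: "\<And>i. strongly_convex_fun \<mu> (f i)"
    and dom_int: "interior (\<Inter>i. edom (f i)) \<noteq> {}"
    and edges: "\<And>k e. e \<in> E k \<Longrightarrow> \<exists>i j. i \<noteq> j \<and> e = {i, j}"
    and h_sym: "\<And>k i j. {i, j} \<in> E k \<Longrightarrow> h k i j = h k j i \<and> h k i j > 0"
    and h_low_pos: "h_low E h > 0"
    and h_sum: "\<And>k i. (\<Sum>j\<in>nbrs (E k) i. h k i j) \<le> 1"
    and beta: "0 < \<beta>" "\<beta> < 1 / L"
    and c_pos: "c1 > 0" "c2 > 0"
    and m_pos: "m \<ge> 1"
    and B_pos: "B \<ge> 1"
    and B_conn: "\<And>k. graph_connected (union_edges E B k)"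
    and w0: "(\<Sum>i\<in>UNIV. w 0 i) = 0"
    and alpha_min: "\<And>k i j. {i, j} \<in> E k \<Longrightarrow>
          aa_minimizer E m dg w k i j (al k i j) (al k j i)"
    and w_step: "\<And>k i. w (Suc k) i =
          (1 - (\<Sum>j\<in>nbrs (E k) i. h k i j)) *\<^sub>R w k i
          + (\<Sum>j\<in>nbrs (E k) i. h k i j *\<^sub>R
               half_step s L \<beta> c1 c2 E m dc dg w k i j (al k i j) (al k j i))"
  shows "\<forall>k.
    (let Dk = Dsum dc (w k) - Dstar dc;
         D0 = Dsum dc (w 0) - Dstar dc;
         R = R0 dc (w 0);
         \<theta>1 = min (\<beta> * (1 - \<beta> * L)) c1;
         \<theta>2 = min ((1 / \<beta> - L) / 2) c2;
         \<tau> = 3 * real B * L\<^sup>2 * eta_tilde E B / \<theta>2 + 3 / (h_low E h * \<theta>1);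
         x = (\<lambda>i. dg i (w k i))
     in Dk \<le> \<tau> * R\<^sup>2 * D0 / (\<tau> * R\<^sup>2 + lambda_low E B * real (k div B) * D0)
      \<and> pnorm (\<lambda>i. x i - xstar f) \<le> sqrt (2 * L * Dk)
      \<and> \<bar>(\<Sum>i\<in>UNIV. real_of_ereal (f i (x i))) - Fstar f\<bar>
          \<le> (R + pnorm (w 0)) * sqrt (2 * L * Dk))"
proof -
  define \<theta>1 where "\<theta>1 = min (\<beta> * (1 - \<beta> * L)) c1"
  define \<theta>2 where "\<theta>2 = min ((1 / \<beta> - L) / 2) c2"
  define p where "p = (\<lambda>k i j. half_step s L \<beta> c1 c2 E m dc dg w k i j (al k i j) (al k j i))"
  have L_pos: "L > 0" unfolding L_def using mu_pos by simp
  interpret dual_problem dc dg \<mu>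
    unfolding dc_def dg_def
    by unfold_locales (use mu_pos conj_fun_cocoercive[OF mu_pos f_proper f_lsc f_sconv]
      conj_fun_sum_growth[OF mu_pos f_proper f_lsc f_sconv dom_int] in auto)
  have pair: "{i, j} \<in> E k \<Longrightarrow> aa_feasible E m w k i j (al k i j) (al k j i)" for k i j
    using alpha_min unfolding aa_minimizer_def by blast
  note L_eq = meta_eq_to_obj_eq[OF L_def]
  interpret pairwise_averaging dc dg \<mu> E h w p \<theta>1 \<theta>2
  proof
    show "i \<notin> nbrs (E k) i" for k i
      using edges[of "{i, i}" k] unfolding nbrs_def by (auto simp: doubleton_eq_iff)
    have "\<beta> * L < 1" using beta L_pos by (simp add: field_simps)
    then show "0 < \<theta>1" "0 < \<theta>2"
      unfolding \<theta>1_def \<theta>2_def using beta c_pos L_pos by (auto simp: field_simps)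
    \<comment> \<open>In \<open>p k j i\<close> the two coefficient vectors appear exchanged, so it
      is exactly the second half step \<open>q\<close> of \<open>half_step_pair\<close>.\<close>
    show "p k i j + p k j i = w k i + w k j" if "{i, j} \<in> E k" for k i j
      unfolding p_def by (rule half_step_pair_sum[OF L_eq beta pair[OF that]])
    show "\<theta>1 * (norm (dg i (w k i) - dg j (w k j)))\<^sup>2
        \<le> dc i (w k i) + dc j (w k j) - dc i (p k i j) - dc j (p k j i)" if "{i, j} \<in> E k" for k i j
      unfolding p_def \<theta>1_def by (rule half_step_decrease_grad[OF L_eq beta pair[OF that]])
    show "\<theta>2 * ((norm (p k i j - w k i))\<^sup>2 + (norm (p k j i - w k j))\<^sup>2)
        \<le> dc i (w k i) + dc j (w k j) - dc i (p k i j) - dc j (p k j i)" if "{i, j} \<in> E k" for k i j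
      unfolding p_def \<theta>2_def by (rule half_step_decrease_step[OF L_eq beta pair[OF that]])
  qed (use h_sym h_sum h_low_pos w0 w_step in \<open>auto simp: p_def\<close>)
  note rate = dual_convergence_rate[OF B_pos B_conn]
  have S0: "w k \<in> S0set (\<lambda>i. conj_fun (f i)) (w 0)" for k
    using iterates_in_S0set unfolding dc_def .
  note dist = primal_distance_bound[OF mu_pos f_proper f_lsc f_sconv dom_int w0 S0]
  note val = primal_value_bound[OF mu_pos f_proper f_lsc f_sconv dom_int w0 S0]
  show ?thesis
    unfolding Let_def \<theta>1_def[symmetric] \<theta>2_def[symmetric]
  proof (intro allI conjI, goal_cases)
    case (1 k) show ?case using rate[of k] unfolding L_def .
  next
    case (2 k) show ?case using dist[of k] unfolding L_def dc_def dg_def .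
  next
    case (3 k) show ?case using val[of k] unfolding L_def dc_def dg_def .
  qed
qed

end
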